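(* Consider a fixed finite instance. Suppose that TUSOU (i) uses the fixed-assignment ordering certification procedure described in the context, (ii) adds only original ordering rows (coupling, decoupling and continuation instances of the full formulation) or globally valid activated cycle inequalities, and (iii) applies a complete branching rule over the finite integer variable set. If a rejected assignment $\bar x$ yields no previously absent original ordering row for lazy recovery, TUSOU adds the assignment-exclusion cut $$\sum_{(h,a):\bar x_a^h=1}(1-x_a^h)+\sum_{(h,a):\bar x_a^h=0}x_a^h\ge1 .$$ Then TUSOU finitely terminates. Every accepted incumbent is feasible for the full ordered-unit formulation $\mathcal P$. If TUSOU terminates with zero optimality gap, the returned schedule is optimal over the projected orderable assignment set $X^{\mathrm{ord}}$, equivalently over the full ordered-unit formulation $\mathcal P$.
   Context: **Network.** $\tilde N$ is a finite set of trips; $0,\infty$ are an artificial source and sink; $N=\tilde N\cup\{0,\infty\}$. The finite arc set is $A=\tilde A\cup\{(0,j):j\in\tilde N\}\cup\{(j,\infty):j\in\tilde N\}$, where $\tilde A\subseteq\tilde N\times\tilde N$ is the set of turn-round arcs, and $(N,A)$ is a directed acyclic graph. $T$ is a finite set of unit types; $H_t$ is the finite set of individual units of type $t$, $b^t=|H_t|$, $H=\bigsqcup_{t\in T}H_t$. A family $f\in F$ is a set of types with size limit $v^f\in\mathbb Z_{\ge1}$; $F_j\subseteq F$ is the nonempty set of families feasible for trip $j$. Each unit $h$ has a feasible arc set $A^h\subseteq A$; an arc of $A^h$ may touch trip $j$ only if the type of $h$ belongs to some $f\in F_j$. $\delta_+^h(i)$, $\delta_-^h(i)$ are the arcs of $A^h$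 leaving, respectively entering, node $i$. Each trip $i$ has a direction $d_i\in\{-1,1\}$ and arrival/departure times $\tau_i^{arr},\tau_i^{dep}$; times that are compared in same-direction coupling/decoupling instances are assumed distinct. $\kappa^t$ is the capacity of type $t$, $r_j$ the demand of trip $j$. **Network constraints**, in binary variables $x_a^h$ ($h\in H,a\in A^h$) and $y_j^f$ ($j\in\tilde N,f\in F_j$): $\sum_{a\in\delta_+^h(0)}x_a^h\le1$ for all $h$; $\sum_{a\in\delta_+^h(j)}x_a^h=\sum_{a\in\delta_-^h(j)}x_a^h$ for all $h$ and $j\in\tilde N$; $\sum_{h\in H_t}\sum_{a\in\delta_+^h(0)}x_a^h\le b^t$ for all $t$; $\sum_t\sum_{h\in H_t}\sum_{a\in\delta_+^h(j)}\kappa^tx_a^h\ge r_j$ for all $j\in\tilde N$; $\sum_{t\in f}\sum_{h\in H_t}\sum_{a\in\delta_+^h(j)}x_a^h\le v^fy_j^f$ for all $j\in\tilde N,f\in F_j$; $\sum_{f\in F_j}y_j^f=1$ for all $j\in\tilde N$. $X^{\mathrm{net}}$ is the set of binary $x$ for which some binary $y$ satisfies these. **Notation.** $s_i^h=\sum_{a\in\delta_+^h(i)}x_a^h$, $q_i=\sum_{h\in H}s_i^h$, $\bar q_i=\max_{f\in F_i}v^f$, $M_i=\bar q_i$. **Order-linking constraints**, in variables $\theta_i^h\in\{0,1,\dots,\bar q_i\}$ and $u_i^{h_1h_2}\in\{0,1\}$ ($i\in\tilde N$, $h,h_1\ne h_2\in H$): $s_i^h\le\theta_i^h\le q_i$;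 $\theta_i^h\le M_is_i^h$; and $1-M_i(1-u_i^{h_1h_2})-M_i(2-s_i^{h_1}-s_i^{h_2})\le\theta_i^{h_1}-\theta_i^{h_2}\le M_iu_i^{h_1h_2}-1+M_i(2-s_i^{h_1}-s_i^{h_2})$. **Ordering instances (original ordering rows)**, for all distinct $h_1,h_2\in H$. (If the input data mark some station events or arcs as permitting shunting/resequencing, the corresponding instances are removed throughout.) - Coupling, for $a_1=(i_1,j)\in A^{h_1}\cap\tilde A$, $a_2=(i_2,j)\in A^{h_2}\cap\tilde A$, with $D=2-x_{a_1}^{h_1}-x_{a_2}^{h_2}$: $d_j(d_{i_1}-d_{i_2})(\theta_j^{h_1}-\theta_j^{h_2})\ge-2\bar q_jD$, and $c\,(\theta_j^{h_1}-\theta_j^{h_2})\ge-|c|\bar q_jD$ where $c=d_j(d_{i_1}+d_{i_2})(\tau_{i_1}^{arr}-\tau_{i_2}^{arr})$. - Decoupling, for $a_1=(i,j_1)\in A^{h_1}\cap\tilde A$, $a_2=(i,j_2)\in A^{h_2}\cap\tilde A$, with $D=2-x_{a_1}^{h_1}-x_{a_2}^{h_2}$: $d_i(d_{j_1}-d_{j_2})(\theta_i^{h_1}-\theta_i^{h_2})\le2\bar q_iD$, and $c\,(\theta_i^{h_1}-\theta_i^{h_2})\ge-|c|\bar q_iD$ where $c=d_i(d_{j_1}+d_{j_2})(\tau_{j_1}^{dep}-\tau_{j_2}^{dep})$. - Continuation, for $a=(i,j)\in\tilde A\cap A^{h_1}\cap A^{h_2}$: $-M^{\mathrm{cont}}_{ij}D\le(\theta_j^{h_1}-\theta_j^{h_2})-d_id_j(\theta_i^{h_1}-\theta_i^{h_2})\le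 M^{\mathrm{cont}}_{ij}D$ with $D=2-x_a^{h_1}-x_a^{h_2}$ and $M^{\mathrm{cont}}_{ij}=2\max\{\bar q_i,\bar q_j,1\}$. An instance is active under $\bar x$ if $D=0$ at $x=\bar x$; $\mathcal L(\bar x)$ is the set of active instances. **Full formulation.** $\mathcal P$ is the set of $(x,y,\theta,u)$ satisfying the network constraints, order-linking constraints, all ordering instances, and the stated integrality/domains. The objective, to be minimised, depends only on $x$: $W_1\sum_{h\in H}\sum_{a\in\delta_+^h(0)}x_a^h+W_2\sum_{t}\sum_{j\in\tilde N^t}\sum_{h\in H_t}\sum_{a\in\delta_+^h(j)}\mu_j^tx_a^h+W_3\sum_t\sum_{a\in E^t}\sum_{h\in H_t}x_a^h$, with given weights $W_r$, mileages $\mu_j^t$, $\tilde N^t$ the trips operable by type $t$, and $E^t$ the type-$t$ empty-running arcs. For $\bar x\in X^{\mathrm{net}}$, $\Omega(\bar x)$ is the set of $(\theta,u)$ satisfying, with $x=\bar x$, the order-linking constraints (with domains) and all instances in $\mathcal L(\bar x)$; $X^{\mathrm{ord}}=\{\bar x\in X^{\mathrm{net}}:\Omega(\bar x)\ne\emptyset\}$. **Activated cycle inequalities.** For a trip $k$ and distinct units $h_1,\dots,h_m$ ($m\ge2$, $h_{m+1}=h_1$): $\sum_{r=1}^mu_k^{h_rh_{r+1}}\ge\sum_{r=1}^ms_k^{h_r}-(m-1)$. **Fixed-assignment ordering certification.** Input: integral $\bar x$. For each trip $k$ let $U_k(\bar x)=\{h:s_k^h(\bar x)=1\}$, $q_k=|U_k(\bar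 x)|$, and let $E_k(\bar x)$ be the set of pairs $(a,b)$ such that some active coupling/decoupling instance on trip $k$ with nonzero coefficient requires $a$ to be ahead of $b$, i.e. $\theta_k^a<\theta_k^b$ (for distinct positions). If some digraph $(U_k(\bar x),E_k(\bar x))$ has a directed cycle, return Reject together with the active instances generating the cycle. Otherwise solve the feasibility problem in binaries $\lambda_{khr}$ ($h\in U_k(\bar x)$, $1\le r\le q_k$), with $p_k^h=\sum_rr\lambda_{khr}$: $\sum_r\lambda_{khr}=1$ for all $k,h$; $\sum_h\lambda_{khr}=1$ for all $k,r$; $p_k^a+1\le p_k^b$ for all $k$ and $(a,b)\in E_k(\bar x)$; $p_j^{h_1}-p_j^{h_2}=d_id_j(p_i^{h_1}-p_i^{h_2})$ for all $a=(i,j)\in\tilde A$ and $h_1\ne h_2$ with $\bar x_a^{h_1}=\bar x_a^{h_2}=1$. If feasible, return Accept with the witness $\theta_k^{h}=p_k^h$ for $h\in U_k(\bar x)$, $\theta_k^h=0$ otherwise, and $u_k^{ab}=1$ iff $\theta_k^a>\theta_k^b$. If infeasible, return Reject with an infeasible subsystem mapped to active instances in $\mathcal L(\bar x)$ (or all of $\mathcal L(\bar x)$). **TUSOU.** A branch-and-bound-and-cut method over the variables $(x,y,\theta,u)$. The LP at each node consists of the continuous relaxation of the network and order-linking constraints, a (template-dependent, possibly empty) subset of the original ordering rows, all globally added cuts so far, and the branching restrictions of the node; its optimal value is the node's lower bound. Activated cycle inequalities violated by the LP solution may be added. Nodes are pruned by infeasibility or by bound against the incumbent. Whenever an integer assignment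 candidate $\bar x\in X^{\mathrm{net}}$ is encountered, certification is run. If it accepts, $\bar x$, completed by a binary $y$ satisfying the network constraints and by the certified witness $(\theta,u)$, is accepted as a feasible schedule (the incumbent being the best accepted schedule). If it rejects, one or more original ordering rows associated with the returned infeasible active subsystem and not yet present are added globally (lazy recovery), or, if there is none, the assignment-exclusion cut in the claim is added. Otherwise the node is branched on by the branching rule. The optimality gap compares the incumbent value with the minimum lower bound over open nodes; zero gap means that they coincide (no open node can improve on the incumbent). *)

theory Defs
  imports Complex_Main "HOL-Library.Extended_Real"
begin

section \<open>Instances\<close>

datatype 'n node = Source | Sink | Trip 'n

type_synonym 'n arc = "'n node \<times> 'n node"

text \<open>
  Index of a single ordering instance.  A coupling (decoupling) pair contributes two instances, each
  with its own coefficient: one for opposite and one for equal directions of the two neighbouring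
  trips.  \<open>CplOpp i1 i2 j h1 h2\<close> belongs to the arcs \<open>(i1,j)\<close> of \<open>h1\<close> and \<open>(i2,j)\<close> of \<open>h2\<close>,
  \<open>DcpOpp i j1 j2 h1 h2\<close> to the arcs \<open>(i,j1)\<close> of \<open>h1\<close> and \<open>(i,j2)\<close> of \<open>h2\<close>.
\<close>

datatype ('n, 'h) ordinst =
    CplOpp 'n 'n 'n 'h 'h
  | CplSame 'n 'n 'n 'h 'h
  | DcpOpp 'n 'n 'n 'h 'h
  | DcpSame 'n 'n 'n 'h 'h
  | Cont 'n 'n 'h 'h

text \<open>
  \<open>exempt\<close> collects the ordering instances removed because the data mark a station event or an arc
  as permitting shunting or resequencing; it is unrestricted and may be empty.
\<close>

record ('n, 't, 'h) rolling =
  trips :: "'n set"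
  turn :: "('n \<times> 'n) set"
  types :: "'t set"
  units :: "'h set"
  utype :: "'h \<Rightarrow> 't"
  families :: "'t set set"
  vlim :: "'t set \<Rightarrow> nat"
  feasfam :: "'n \<Rightarrow> 't set set"
  uarcs :: "'h \<Rightarrow> 'n arc set"
  dirn :: "'n \<Rightarrow> real"
  tarr :: "'n \<Rightarrow> real"
  tdep :: "'n \<Rightarrow> real"
  capac :: "'t \<Rightarrow> real"
  demand :: "'n \<Rightarrow> real"
  exempt :: "('n, 'h) ordinst set"
  weight1 :: real
  weight2 :: real
  weight3 :: real
  mileage :: "'n \<Rightarrow> 't \<Rightarrow> real"
  empty_arcs :: "'t \<Rightarrow> 'n arc set"

definition arcs :: "('n, 't, 'h) rolling \<Rightarrow> 'n arc set" where
  "arcs I = (\<lambda>(i, j). (Trip i, Trip j)) ` turn I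
     \<union> {(Source, Trip j) | j. j \<in> trips I} \<union> {(Trip j, Sink) | j. j \<in> trips I}"

definition units_of :: "('n, 't, 'h) rolling \<Rightarrow> 't \<Rightarrow> 'h set" where
  "units_of I t = {h \<in> units I. utype I h = t}"

definition out_arcs :: "('n, 't, 'h) rolling \<Rightarrow> 'h \<Rightarrow> 'n node \<Rightarrow> 'n arc set" where
  "out_arcs I h v = {a \<in> uarcs I h. fst a = v}"

definition in_arcs :: "('n, 't, 'h) rolling \<Rightarrow> 'h \<Rightarrow> 'n node \<Rightarrow> 'n arc set" where
  "in_arcs I h v = {a \<in> uarcs I h. snd a = v}"

definition qbar :: "('n, 't, 'h) rolling \<Rightarrow> 'n \<Rightarrow> nat" where
  "qbar I i = Max (vlim I ` feasfam I i)"

definition operable :: "('n, 't, 'h) rolling \<Rightarrow> 't \<Rightarrow> 'n set" where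
  "operable I t = {j \<in> trips I. \<exists>f \<in> feasfam I j. t \<in> f}"

definition unit_turn :: "('n, 't, 'h) rolling \<Rightarrow> 'h \<Rightarrow> 'n \<Rightarrow> 'n \<Rightarrow> bool" where
  "unit_turn I h i j \<longleftrightarrow> (i, j) \<in> turn I \<and> (Trip i, Trip j) \<in> uarcs I h"

fun ord_index :: "('n, 't, 'h) rolling \<Rightarrow> ('n, 'h) ordinst \<Rightarrow> bool" where
  "ord_index I (CplOpp i1 i2 j h1 h2) \<longleftrightarrow>
     h1 \<in> units I \<and> h2 \<in> units I \<and> h1 \<noteq> h2 \<and> unit_turn I h1 i1 j \<and> unit_turn I h2 i2 j"
| "ord_index I (CplSame i1 i2 j h1 h2) \<longleftrightarrow>
     h1 \<in> units I \<and> h2 \<in> units I \<and> h1 \<noteq> h2 \<and> unit_turn I h1 i1 j \<and> unit_turn I h2 i2 j"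
| "ord_index I (DcpOpp i j1 j2 h1 h2) \<longleftrightarrow>
     h1 \<in> units I \<and> h2 \<in> units I \<and> h1 \<noteq> h2 \<and> unit_turn I h1 i j1 \<and> unit_turn I h2 i j2"
| "ord_index I (DcpSame i j1 j2 h1 h2) \<longleftrightarrow>
     h1 \<in> units I \<and> h2 \<in> units I \<and> h1 \<noteq> h2 \<and> unit_turn I h1 i j1 \<and> unit_turn I h2 i j2"
| "ord_index I (Cont i j h1 h2) \<longleftrightarrow>
     h1 \<in> units I \<and> h2 \<in> units I \<and> h1 \<noteq> h2 \<and> unit_turn I h1 i j \<and> unit_turn I h2 i j"

definition ord_rows :: "('n, 't, 'h) rolling \<Rightarrow> ('n, 'h) ordinst set" where
  "ord_rows I = {r. ord_index I r} - exempt I"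

definition rolling_instance :: "('n, 't, 'h) rolling \<Rightarrow> bool" where
  "rolling_instance I \<longleftrightarrow>
     finite (trips I) \<and> finite (types I) \<and> finite (units I) \<and>
     turn I \<subseteq> trips I \<times> trips I \<and> acyclic (arcs I) \<and>
     utype I ` units I \<subseteq> types I \<and>
     families I \<subseteq> Pow (types I) \<and> (\<forall>f \<in> families I. 1 \<le> vlim I f) \<and>
     (\<forall>j \<in> trips I. feasfam I j \<noteq> {} \<and> feasfam I j \<subseteq> families I) \<and>
     (\<forall>h \<in> units I. uarcs I h \<subseteq> arcs I \<and>
        (\<forall>a \<in> uarcs I h. \<forall>j. fst a = Trip j \<or> snd a = Trip j \<longrightarrow>
           (\<exists>f \<in> feasfam I j. utype I h \<in> f))) \<and>
     (\<forall>i \<in> trips I. dirn I i \<in> {-1, 1}) \<and>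
     (\<forall>i1 i2 j h1 h2. CplSame i1 i2 j h1 h2 \<in> ord_rows I \<and> i1 \<noteq> i2 \<and> dirn I i1 = dirn I i2 \<longrightarrow>
        tarr I i1 \<noteq> tarr I i2) \<and>
     (\<forall>i j1 j2 h1 h2. DcpSame i j1 j2 h1 h2 \<in> ord_rows I \<and> j1 \<noteq> j2 \<and> dirn I j1 = dirn I j2 \<longrightarrow>
        tdep I j1 \<noteq> tdep I j2) \<and>
     (\<forall>t \<in> types I. empty_arcs I t \<subseteq> arcs I)"

section \<open>The full ordered-unit formulation\<close>

text \<open>
  Vectors are total functions that are required to vanish outside their index sets, so that equality
  of functions is equality of vectors.
\<close>

type_synonym ('n, 'h) xvec = "'h \<Rightarrow> 'n arc \<Rightarrow> real"
type_synonym ('n, 't) yvec = "'n \<Rightarrow> 't set \<Rightarrow> real"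
type_synonym ('n, 'h) thvec = "'n \<Rightarrow> 'h \<Rightarrow> real"
type_synonym ('n, 'h) uvec = "'n \<Rightarrow> 'h \<Rightarrow> 'h \<Rightarrow> real"

record ('n, 't, 'h) point =
  px :: "('n, 'h) xvec"
  py :: "('n, 't) yvec"
  pth :: "('n, 'h) thvec"
  pu :: "('n, 'h) uvec"

definition x_dom :: "('n, 't, 'h) rolling \<Rightarrow> ('n, 'h) xvec \<Rightarrow> bool" where
  "x_dom I x \<longleftrightarrow> (\<forall>h a. x h a \<in> (if h \<in> units I \<and> a \<in> uarcs I h then {0, 1} else {0}))"

definition y_dom :: "('n, 't, 'h) rolling \<Rightarrow> ('n, 't) yvec \<Rightarrow> bool" where
  "y_dom I y \<longleftrightarrow> (\<forall>j f. y j f \<in> (if j \<in> trips I \<and> f \<in> feasfam I j then {0, 1} else {0}))"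

definition th_dom :: "('n, 't, 'h) rolling \<Rightarrow> ('n, 'h) thvec \<Rightarrow> bool" where
  "th_dom I \<theta> \<longleftrightarrow>
     (\<forall>i h. \<theta> i h \<in> (if i \<in> trips I \<and> h \<in> units I then of_nat ` {0..qbar I i} else {0}))"

definition u_dom :: "('n, 't, 'h) rolling \<Rightarrow> ('n, 'h) uvec \<Rightarrow> bool" where
  "u_dom I u \<longleftrightarrow> (\<forall>i h1 h2. u i h1 h2 \<in>
     (if i \<in> trips I \<and> h1 \<in> units I \<and> h2 \<in> units I \<and> h1 \<noteq> h2 then {0, 1} else {0}))"

definition served :: "('n, 't, 'h) rolling \<Rightarrow> ('n, 'h) xvec \<Rightarrow> 'n \<Rightarrow> 'h \<Rightarrow> real" where
  "served I x i h = (\<Sum>a \<in> out_arcs I h (Trip i). x h a)"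

definition qtot :: "('n, 't, 'h) rolling \<Rightarrow> ('n, 'h) xvec \<Rightarrow> 'n \<Rightarrow> real" where
  "qtot I x i = (\<Sum>h \<in> units I. served I x i h)"

definition network :: "('n, 't, 'h) rolling \<Rightarrow> ('n, 'h) xvec \<Rightarrow> ('n, 't) yvec \<Rightarrow> bool" where
  "network I x y \<longleftrightarrow>
     (\<forall>h \<in> units I. (\<Sum>a \<in> out_arcs I h Source. x h a) \<le> 1) \<and>
     (\<forall>h \<in> units I. \<forall>j \<in> trips I.
        (\<Sum>a \<in> out_arcs I h (Trip j). x h a) = (\<Sum>a \<in> in_arcs I h (Trip j). x h a)) \<and>
     (\<forall>t \<in> types I. (\<Sum>h \<in> units_of I t. \<Sum>a \<in> out_arcs I h Source. x h a)
        \<le> real (card (units_of I t))) \<and>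
     (\<forall>j \<in> trips I. (\<Sum>t \<in> types I. \<Sum>h \<in> units_of I t. \<Sum>a \<in> out_arcs I h (Trip j).
        capac I t * x h a) \<ge> demand I j) \<and>
     (\<forall>j \<in> trips I. \<forall>f \<in> feasfam I j.
        (\<Sum>t \<in> f. \<Sum>h \<in> units_of I t. \<Sum>a \<in> out_arcs I h (Trip j). x h a)
        \<le> real (vlim I f) * y j f) \<and>
     (\<forall>j \<in> trips I. (\<Sum>f \<in> feasfam I j. y j f) = 1)"

definition Xnet :: "('n, 't, 'h) rolling \<Rightarrow> ('n, 'h) xvec set" where
  "Xnet I = {x. x_dom I x \<and> (\<exists>y. y_dom I y \<and> network I x y)}"

definition order_linking ::
  "('n, 't, 'h) rolling \<Rightarrow> ('n, 'h) xvec \<Rightarrow> ('n, 'h) thvec \<Rightarrow> ('n, 'h) uvec \<Rightarrow> bool" where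
  "order_linking I x \<theta> u \<longleftrightarrow>
     (\<forall>i \<in> trips I. \<forall>h \<in> units I.
        served I x i h \<le> \<theta> i h \<and> \<theta> i h \<le> qtot I x i \<and>
        \<theta> i h \<le> real (qbar I i) * served I x i h) \<and>
     (\<forall>i \<in> trips I. \<forall>h1 \<in> units I. \<forall>h2 \<in> units I. h1 \<noteq> h2 \<longrightarrow>
        1 - real (qbar I i) * (1 - u i h1 h2)
          - real (qbar I i) * (2 - served I x i h1 - served I x i h2) \<le> \<theta> i h1 - \<theta> i h2 \<and>
        \<theta> i h1 - \<theta> i h2 \<le> real (qbar I i) * u i h1 h2 - 1
          + real (qbar I i) * (2 - served I x i h1 - served I x i h2))"

text \<open>The value of \<open>D\<close> in an ordering instance.\<close>

fun deact :: "('n, 'h) xvec \<Rightarrow> ('n, 'h) ordinst \<Rightarrow> real" where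
  "deact x (CplOpp i1 i2 j h1 h2) = 2 - x h1 (Trip i1, Trip j) - x h2 (Trip i2, Trip j)"
| "deact x (CplSame i1 i2 j h1 h2) = 2 - x h1 (Trip i1, Trip j) - x h2 (Trip i2, Trip j)"
| "deact x (DcpOpp i j1 j2 h1 h2) = 2 - x h1 (Trip i, Trip j1) - x h2 (Trip i, Trip j2)"
| "deact x (DcpSame i j1 j2 h1 h2) = 2 - x h1 (Trip i, Trip j1) - x h2 (Trip i, Trip j2)"
| "deact x (Cont i j h1 h2) = 2 - x h1 (Trip i, Trip j) - x h2 (Trip i, Trip j)"

text \<open>The coefficient of \<open>\<theta> h1 - \<theta> h2\<close> in a coupling or decoupling instance.\<close>

fun ord_coef :: "('n, 't, 'h) rolling \<Rightarrow> ('n, 'h) ordinst \<Rightarrow> real" where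
  "ord_coef I (CplOpp i1 i2 j h1 h2) = dirn I j * (dirn I i1 - dirn I i2)"
| "ord_coef I (CplSame i1 i2 j h1 h2) = dirn I j * (dirn I i1 + dirn I i2) * (tarr I i1 - tarr I i2)"
| "ord_coef I (DcpOpp i j1 j2 h1 h2) = dirn I i * (dirn I j1 - dirn I j2)"
| "ord_coef I (DcpSame i j1 j2 h1 h2) = dirn I i * (dirn I j1 + dirn I j2) * (tdep I j1 - tdep I j2)"
| "ord_coef I (Cont i j h1 h2) = 0"

definition Mcont :: "('n, 't, 'h) rolling \<Rightarrow> 'n \<Rightarrow> 'n \<Rightarrow> real" where
  "Mcont I i j = 2 * real (max (max (qbar I i) (qbar I j)) 1)"

fun ord_holds ::
  "('n, 't, 'h) rolling \<Rightarrow> ('n, 'h) xvec \<Rightarrow> ('n, 'h) thvec \<Rightarrow> ('n, 'h) ordinst \<Rightarrow> bool" where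
  "ord_holds I x \<theta> (CplOpp i1 i2 j h1 h2) \<longleftrightarrow>
     ord_coef I (CplOpp i1 i2 j h1 h2) * (\<theta> j h1 - \<theta> j h2)
       \<ge> - 2 * real (qbar I j) * deact x (CplOpp i1 i2 j h1 h2)"
| "ord_holds I x \<theta> (CplSame i1 i2 j h1 h2) \<longleftrightarrow>
     ord_coef I (CplSame i1 i2 j h1 h2) * (\<theta> j h1 - \<theta> j h2)
       \<ge> - \<bar>ord_coef I (CplSame i1 i2 j h1 h2)\<bar> * real (qbar I j) * deact x (CplSame i1 i2 j h1 h2)"
| "ord_holds I x \<theta> (DcpOpp i j1 j2 h1 h2) \<longleftrightarrow>
     ord_coef I (DcpOpp i j1 j2 h1 h2) * (\<theta> i h1 - \<theta> i h2)
       \<le> 2 * real (qbar I i) * deact x (DcpOpp i j1 j2 h1 h2)"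
| "ord_holds I x \<theta> (DcpSame i j1 j2 h1 h2) \<longleftrightarrow>
     ord_coef I (DcpSame i j1 j2 h1 h2) * (\<theta> i h1 - \<theta> i h2)
       \<ge> - \<bar>ord_coef I (DcpSame i j1 j2 h1 h2)\<bar> * real (qbar I i) * deact x (DcpSame i j1 j2 h1 h2)"
| "ord_holds I x \<theta> (Cont i j h1 h2) \<longleftrightarrow>
     - Mcont I i j * deact x (Cont i j h1 h2)
       \<le> (\<theta> j h1 - \<theta> j h2) - dirn I i * dirn I j * (\<theta> i h1 - \<theta> i h2) \<and>
     (\<theta> j h1 - \<theta> j h2) - dirn I i * dirn I j * (\<theta> i h1 - \<theta> i h2)
       \<le> Mcont I i j * deact x (Cont i j h1 h2)"

definition active :: "('n, 't, 'h) rolling \<Rightarrow> ('n, 'h) xvec \<Rightarrow> ('n, 'h) ordinst set" where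
  "active I x = {r \<in> ord_rows I. deact x r = 0}"

definition Pfull :: "('n, 't, 'h) rolling \<Rightarrow> ('n, 't, 'h) point set" where
  "Pfull I = {z. x_dom I (px z) \<and> y_dom I (py z) \<and> th_dom I (pth z) \<and> u_dom I (pu z) \<and>
     network I (px z) (py z) \<and> order_linking I (px z) (pth z) (pu z) \<and>
     (\<forall>r \<in> ord_rows I. ord_holds I (px z) (pth z) r)}"

definition Omega ::
  "('n, 't, 'h) rolling \<Rightarrow> ('n, 'h) xvec \<Rightarrow> (('n, 'h) thvec \<times> ('n, 'h) uvec) set" where
  "Omega I x = {(\<theta>, u). th_dom I \<theta> \<and> u_dom I u \<and> order_linking I x \<theta> u \<and>
     (\<forall>r \<in> active I x. ord_holds I x \<theta> r)}"

definition Xord :: "('n, 't, 'h) rolling \<Rightarrow> ('n, 'h) xvec set" where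
  "Xord I = {x \<in> Xnet I. Omega I x \<noteq> {}}"

definition cost :: "('n, 't, 'h) rolling \<Rightarrow> ('n, 'h) xvec \<Rightarrow> real" where
  "cost I x =
     weight1 I * (\<Sum>h \<in> units I. \<Sum>a \<in> out_arcs I h Source. x h a)
   + weight2 I * (\<Sum>t \<in> types I. \<Sum>j \<in> operable I t. \<Sum>h \<in> units_of I t.
        \<Sum>a \<in> out_arcs I h (Trip j). mileage I j t * x h a)
   + weight3 I * (\<Sum>t \<in> types I. \<Sum>a \<in> empty_arcs I t. \<Sum>h \<in> units_of I t. x h a)"

section \<open>Fixed-assignment ordering certification\<close>

definition U_set :: "('n, 't, 'h) rolling \<Rightarrow> ('n, 'h) xvec \<Rightarrow> 'n \<Rightarrow> 'h set" where
  "U_set I x k = {h \<in> units I. served I x k h = 1}"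

text \<open>
  \<open>forces I r k a b\<close>: when active, \<open>r\<close> is an instance on trip \<open>k\<close> whose nonzero coefficient requires
  \<open>a\<close> to be ahead of \<open>b\<close>.  All rows but \<open>DcpOpp\<close> are of the form
  \<open>coefficient * (\<theta> h1 - \<theta> h2) \<ge> 0\<close> when active, and so put \<open>h2\<close> ahead if the coefficient is
  positive; \<open>DcpOpp\<close> is a \<open>\<le>\<close>-row.
\<close>

fun forces :: "('n, 't, 'h) rolling \<Rightarrow> ('n, 'h) ordinst \<Rightarrow> 'n \<Rightarrow> 'h \<Rightarrow> 'h \<Rightarrow> bool" where
  "forces I (CplOpp i1 i2 j h1 h2) k a b \<longleftrightarrow> k = j \<and>
     (0 < ord_coef I (CplOpp i1 i2 j h1 h2) \<and> a = h2 \<and> b = h1 \<or>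
      ord_coef I (CplOpp i1 i2 j h1 h2) < 0 \<and> a = h1 \<and> b = h2)"
| "forces I (CplSame i1 i2 j h1 h2) k a b \<longleftrightarrow> k = j \<and>
     (0 < ord_coef I (CplSame i1 i2 j h1 h2) \<and> a = h2 \<and> b = h1 \<or>
      ord_coef I (CplSame i1 i2 j h1 h2) < 0 \<and> a = h1 \<and> b = h2)"
| "forces I (DcpOpp i j1 j2 h1 h2) k a b \<longleftrightarrow> k = i \<and>
     (0 < ord_coef I (DcpOpp i j1 j2 h1 h2) \<and> a = h1 \<and> b = h2 \<or>
      ord_coef I (DcpOpp i j1 j2 h1 h2) < 0 \<and> a = h2 \<and> b = h1)"
| "forces I (DcpSame i j1 j2 h1 h2) k a b \<longleftrightarrow> k = i \<and>
     (0 < ord_coef I (DcpSame i j1 j2 h1 h2) \<and> a = h2 \<and> b = h1 \<or>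
      ord_coef I (DcpSame i j1 j2 h1 h2) < 0 \<and> a = h1 \<and> b = h2)"
| "forces I (Cont i j h1 h2) k a b \<longleftrightarrow> False"

definition prec_edges ::
  "('n, 't, 'h) rolling \<Rightarrow> ('n, 'h) ordinst set \<Rightarrow> 'n \<Rightarrow> ('h \<times> 'h) set" where
  "prec_edges I S k = {(a, b). \<exists>r \<in> S. forces I r k a b}"

definition cycle_edges :: "'h list \<Rightarrow> ('h \<times> 'h) set" where
  "cycle_edges vs = set (zip vs (rotate1 vs))"

definition dicycle :: "'h set \<Rightarrow> ('h \<times> 'h) set \<Rightarrow> 'h list \<Rightarrow> bool" where
  "dicycle V E vs \<longleftrightarrow> vs \<noteq> [] \<and> distinct vs \<and> set vs \<subseteq> V \<and> cycle_edges vs \<subseteq> E"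

definition position :: "('n, 't, 'h) rolling \<Rightarrow> ('n, 'h) xvec \<Rightarrow> ('n \<Rightarrow> 'h \<Rightarrow> nat \<Rightarrow> real)
    \<Rightarrow> 'n \<Rightarrow> 'h \<Rightarrow> real" where
  "position I x lam k h = (\<Sum>r = 1..card (U_set I x k). real r * lam k h r)"

text \<open>
  The position problem in which only the precedences and continuation equations stemming from the
  instances in \<open>S\<close> are imposed; the problem solved by certification is the case
  \<open>S = active I x\<close>, and smaller \<open>S\<close> describe its subsystems.
\<close>

definition position_system :: "('n, 't, 'h) rolling \<Rightarrow> ('n, 'h) xvec \<Rightarrow> ('n, 'h) ordinst set
    \<Rightarrow> ('n \<Rightarrow> 'h \<Rightarrow> nat \<Rightarrow> real) \<Rightarrow> bool" where
  "position_system I x S lam \<longleftrightarrow>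
     (\<forall>k \<in> trips I. \<forall>h \<in> U_set I x k. \<forall>r \<in> {1..card (U_set I x k)}. lam k h r \<in> {0, 1}) \<and>
     (\<forall>k \<in> trips I. \<forall>h \<in> U_set I x k. (\<Sum>r = 1..card (U_set I x k). lam k h r) = 1) \<and>
     (\<forall>k \<in> trips I. \<forall>r \<in> {1..card (U_set I x k)}. (\<Sum>h \<in> U_set I x k. lam k h r) = 1) \<and>
     (\<forall>k \<in> trips I. \<forall>(a, b) \<in> prec_edges I S k.
        position I x lam k a + 1 \<le> position I x lam k b) \<and>
     (\<forall>i j h1 h2. Cont i j h1 h2 \<in> S \<longrightarrow>
        position I x lam j h1 - position I x lam j h2
          = dirn I i * dirn I j * (position I x lam i h1 - position I x lam i h2))"

definition witness_th :: "('n, 't, 'h) rolling \<Rightarrow> ('n, 'h) xvec \<Rightarrow> ('n \<Rightarrow> 'h \<Rightarrow> nat \<Rightarrow> real)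
    \<Rightarrow> ('n, 'h) thvec" where
  "witness_th I x lam k h =
     (if k \<in> trips I \<and> h \<in> U_set I x k then position I x lam k h else 0)"

definition witness_u :: "('n, 't, 'h) rolling \<Rightarrow> ('n, 'h) thvec \<Rightarrow> ('n, 'h) uvec" where
  "witness_u I \<theta> k a b =
     (if k \<in> trips I \<and> a \<in> units I \<and> b \<in> units I \<and> a \<noteq> b \<and> \<theta> k a > \<theta> k b then 1 else 0)"

datatype ('n, 'h) verdict =
    Accept "('n, 'h) thvec" "('n, 'h) uvec"
  | Reject "('n, 'h) ordinst set"

text \<open>
  Certification is a relation because the cycle, the solution of the position problem and the
  infeasible subsystem are not determined by the assignment.
\<close>

inductive certifies ::
  "('n, 't, 'h) rolling \<Rightarrow> ('n, 'h) xvec \<Rightarrow> ('n, 'h) verdict \<Rightarrow> bool"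
  for I :: "('n, 't, 'h) rolling" and x :: "('n, 'h) xvec" where
  reject_cycle:
    "\<lbrakk>k \<in> trips I; dicycle (U_set I x k) (prec_edges I (active I x) k) vs;
      S \<subseteq> active I x; cycle_edges vs \<subseteq> prec_edges I S k;
      \<forall>r \<in> S. \<exists>(a, b) \<in> cycle_edges vs. forces I r k a b\<rbrakk>
     \<Longrightarrow> certifies I x (Reject S)"
| accept:
    "\<lbrakk>\<forall>k \<in> trips I. \<nexists>vs. dicycle (U_set I x k) (prec_edges I (active I x) k) vs;
      position_system I x (active I x) lam\<rbrakk>
     \<Longrightarrow> certifies I x (Accept (witness_th I x lam) (witness_u I (witness_th I x lam)))"
| reject_infeasible:
    "\<lbrakk>\<forall>k \<in> trips I. \<nexists>vs. dicycle (U_set I x k) (prec_edges I (active I x) k) vs;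
      \<nexists>lam. position_system I x (active I x) lam;
      S \<subseteq> active I x; \<nexists>lam. position_system I x S lam\<rbrakk>
     \<Longrightarrow> certifies I x (Reject S)"

section \<open>Node relaxations\<close>

datatype ('n, 'h) cut =
    OrdRow "('n, 'h) ordinst"
  | Cycle 'n "'h list"
  | Exclude "('n, 'h) xvec"

definition cycle_index :: "('n, 't, 'h) rolling \<Rightarrow> 'n \<Rightarrow> 'h list \<Rightarrow> bool" where
  "cycle_index I k hs \<longleftrightarrow> k \<in> trips I \<and> 2 \<le> length hs \<and> distinct hs \<and> set hs \<subseteq> units I"

fun cut_holds :: "('n, 't, 'h) rolling \<Rightarrow> ('n, 't, 'h) point \<Rightarrow> ('n, 'h) cut \<Rightarrow> bool" where
  "cut_holds I p (OrdRow r) \<longleftrightarrow> ord_holds I (px p) (pth p) r"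
| "cut_holds I p (Cycle k hs) \<longleftrightarrow>
     (\<Sum>r < length hs. pu p k (hs ! r) (hs ! (Suc r mod length hs)))
       \<ge> (\<Sum>r < length hs. served I (px p) k (hs ! r)) - (real (length hs) - 1)"
| "cut_holds I p (Exclude x) \<longleftrightarrow>
     (\<Sum>(h, a) \<in> {(h, a) \<in> Sigma (units I) (uarcs I). x h a = 1}. 1 - px p h a)
     + (\<Sum>(h, a) \<in> {(h, a) \<in> Sigma (units I) (uarcs I). x h a = 0}. px p h a) \<ge> 1"

datatype ('n, 't, 'h) var =
    VX 'h "'n arc"
  | VY 'n "'t set"
  | VT 'n 'h
  | VU 'n 'h 'h

fun val :: "('n, 't, 'h) point \<Rightarrow> ('n, 't, 'h) var \<Rightarrow> real" where
  "val p (VX h a) = px p h a"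
| "val p (VY j f) = py p j f"
| "val p (VT i h) = pth p i h"
| "val p (VU i h1 h2) = pu p i h1 h2"

text \<open>Upper bound of a variable; \<open>0\<close> off the index sets, in accordance with the convention above.\<close>

fun var_ub :: "('n, 't, 'h) rolling \<Rightarrow> ('n, 't, 'h) var \<Rightarrow> real" where
  "var_ub I (VX h a) = (if h \<in> units I \<and> a \<in> uarcs I h then 1 else 0)"
| "var_ub I (VY j f) = (if j \<in> trips I \<and> f \<in> feasfam I j then 1 else 0)"
| "var_ub I (VT i h) = (if i \<in> trips I \<and> h \<in> units I then real (qbar I i) else 0)"
| "var_ub I (VU i h1 h2) =
     (if i \<in> trips I \<and> h1 \<in> units I \<and> h2 \<in> units I \<and> h1 \<noteq> h2 then 1 else 0)"

definition relaxed_dom :: "('n, 't, 'h) rolling \<Rightarrow> ('n, 't, 'h) point \<Rightarrow> bool" where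
  "relaxed_dom I p \<longleftrightarrow> (\<forall>v. 0 \<le> val p v \<and> val p v \<le> var_ub I v)"

text \<open>A node of the search tree is identified with its set of branching restrictions.\<close>

datatype ('n, 't, 'h) restr =
    AtMost "('n, 't, 'h) var" int
  | AtLeast "('n, 't, 'h) var" int

type_synonym ('n, 't, 'h) bnode = "('n, 't, 'h) restr set"

fun restr_holds :: "('n, 't, 'h) point \<Rightarrow> ('n, 't, 'h) restr \<Rightarrow> bool" where
  "restr_holds p (AtMost v c) \<longleftrightarrow> val p v \<le> real_of_int c"
| "restr_holds p (AtLeast v c) \<longleftrightarrow> real_of_int c \<le> val p v"

definition lp_feasible :: "('n, 't, 'h) rolling \<Rightarrow> ('n, 'h) cut set \<Rightarrow> ('n, 't, 'h) bnode
    \<Rightarrow> ('n, 't, 'h) point set" where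
  "lp_feasible I pool N = {p. relaxed_dom I p \<and> network I (px p) (py p) \<and>
     order_linking I (px p) (pth p) (pu p) \<and> (\<forall>c \<in> pool. cut_holds I p c) \<and>
     (\<forall>b \<in> N. restr_holds p b)}"

definition lp_optimal :: "('n, 't, 'h) rolling \<Rightarrow> ('n, 'h) cut set \<Rightarrow> ('n, 't, 'h) bnode
    \<Rightarrow> ('n, 't, 'h) point \<Rightarrow> bool" where
  "lp_optimal I pool N p \<longleftrightarrow> is_arg_min (\<lambda>p. cost I (px p)) (\<lambda>p. p \<in> lp_feasible I pool N) p"

text \<open>The optimal value of the node relaxation, \<open>\<infinity>\<close> if it is infeasible.\<close>

definition lower_bound :: "('n, 't, 'h) rolling \<Rightarrow> ('n, 'h) cut set \<Rightarrow> ('n, 't, 'h) bnode \<Rightarrow> ereal" where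
  "lower_bound I pool N = (INF p \<in> lp_feasible I pool N. ereal (cost I (px p)))"

section \<open>TUSOU\<close>

record ('n, 't, 'h) tstate =
  open_nodes :: "('n, 't, 'h) bnode set"
  pool :: "('n, 'h) cut set"
  incumbent :: "('n, 't, 'h) point option"

text \<open>\<open>R0\<close> is the template-dependent set of ordering rows present from the outset.\<close>

definition tusou_init :: "('n, 'h) ordinst set \<Rightarrow> ('n, 't, 'h) tstate" where
  "tusou_init R0 = \<lparr>open_nodes = {{}}, pool = OrdRow ` R0, incumbent = None\<rparr>"

definition improves :: "('n, 't, 'h) rolling \<Rightarrow> ereal \<Rightarrow> ('n, 't, 'h) tstate \<Rightarrow> bool" where
  "improves I w s \<longleftrightarrow> (\<forall>z. incumbent s = Some z \<longrightarrow> w < ereal (cost I (px z)))"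

definition node_int_points ::
  "('n, 't, 'h) rolling \<Rightarrow> ('n, 't, 'h) bnode \<Rightarrow> ('n, 't, 'h) point set" where
  "node_int_points I N = {p. x_dom I (px p) \<and> y_dom I (py p) \<and> th_dom I (pth p) \<and> u_dom I (pu p) \<and>
     (\<forall>b \<in> N. restr_holds p b)}"

type_synonym ('n, 't, 'h) brule =
  "('n, 't, 'h) tstate \<Rightarrow> ('n, 't, 'h) bnode \<Rightarrow> ('n, 't, 'h) point \<Rightarrow> ('n, 't, 'h) bnode set"

text \<open>
  A branching rule maps a state, an open node and a solution of the node relaxation to the children of
  that node.  It is complete if, wherever it is called, the finitely many children add bounds on
  integer variables, jointly retain every integer point of the node, and each exclude at least one.
  Branching on any unfixed integer variable by splitting its current domain has this property.
\<close>

definition complete_branching :: "('n, 't, 'h) rolling \<Rightarrow> ('n, 't, 'h) brule \<Rightarrow> bool" where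
  "complete_branching I br \<longleftrightarrow>
     (\<forall>s N p. N \<in> open_nodes s \<and> lp_optimal I (pool s) N p \<and> px p \<notin> Xnet I \<longrightarrow>
        finite (br s N p) \<and> (\<forall>M \<in> br s N p. N \<subseteq> M) \<and>
        node_int_points I N = (\<Union>M \<in> br s N p. node_int_points I M) \<and>
        (\<forall>M \<in> br s N p. node_int_points I M \<subset> node_int_points I N))"

text \<open>
  In the three certification steps the candidate \<open>x\<close> may come from a node relaxation or from any other
  source, such as a primal heuristic; examining a candidate that changes neither the incumbent nor
  the pool is not counted as a step.  An open node whose current relaxation has a solution with
  \<open>x\<close>-part in \<open>Xnet\<close> is not branched on at that solution.  A node whose candidate has been accepted stays
  open until it is pruned by bound.
\<close>

inductive tusou_step ::
  "('n, 't, 'h) rolling \<Rightarrow> ('n, 't, 'h) brule \<Rightarrow> ('n, 't, 'h) tstate \<Rightarrow> ('n, 't, 'h) tstate \<Rightarrow> bool"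
  for I :: "('n, 't, 'h) rolling" and br :: "('n, 't, 'h) brule" where
  prune_infeasible:
    "\<lbrakk>N \<in> open_nodes s; lp_feasible I (pool s) N = {}\<rbrakk>
     \<Longrightarrow> tusou_step I br s (s\<lparr>open_nodes := open_nodes s - {N}\<rparr>)"
| prune_bound:
    "\<lbrakk>N \<in> open_nodes s; \<not> improves I (lower_bound I (pool s) N) s\<rbrakk>
     \<Longrightarrow> tusou_step I br s (s\<lparr>open_nodes := open_nodes s - {N}\<rparr>)"
| add_cycle_cuts:
    "\<lbrakk>N \<in> open_nodes s; lp_optimal I (pool s) N p; C \<noteq> {};
      C \<subseteq> {Cycle k hs | k hs. cycle_index I k hs \<and> \<not> cut_holds I p (Cycle k hs)}\<rbrakk>
     \<Longrightarrow> tusou_step I br s (s\<lparr>pool := pool s \<union> C\<rparr>)"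
| accept_candidate:
    "\<lbrakk>open_nodes s \<noteq> {}; x \<in> Xnet I; certifies I x (Accept \<theta> u); y_dom I y; network I x y;
      improves I (ereal (cost I x)) s\<rbrakk>
     \<Longrightarrow> tusou_step I br s (s\<lparr>incumbent := Some \<lparr>px = x, py = y, pth = \<theta>, pu = u\<rparr>\<rparr>)"
| lazy_recovery:
    "\<lbrakk>open_nodes s \<noteq> {}; x \<in> Xnet I; certifies I x (Reject S);
      R \<noteq> {}; R \<subseteq> {r \<in> S. OrdRow r \<notin> pool s}\<rbrakk>
     \<Longrightarrow> tusou_step I br s (s\<lparr>pool := pool s \<union> OrdRow ` R\<rparr>)"
| exclude_assignment:
    "\<lbrakk>open_nodes s \<noteq> {}; x \<in> Xnet I; certifies I x (Reject S);
      {r \<in> S. OrdRow r \<notin> pool s} = {}; Exclude x \<notin> pool s\<rbrakk>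
     \<Longrightarrow> tusou_step I br s (s\<lparr>pool := insert (Exclude x) (pool s)\<rparr>)"
| branch:
    "\<lbrakk>N \<in> open_nodes s; improves I (lower_bound I (pool s) N) s;
      lp_optimal I (pool s) N p; px p \<notin> Xnet I\<rbrakk>
     \<Longrightarrow> tusou_step I br s (s\<lparr>open_nodes := (open_nodes s - {N}) \<union> br s N p\<rparr>)"

definition tusou_reachable :: "('n, 't, 'h) rolling \<Rightarrow> ('n, 't, 'h) brule \<Rightarrow> ('n, 'h) ordinst set
    \<Rightarrow> ('n, 't, 'h) tstate \<Rightarrow> bool" where
  "tusou_reachable I br R0 s \<longleftrightarrow> (tusou_step I br)\<^sup>*\<^sup>* (tusou_init R0) s"

text \<open>No open node can improve on the incumbent \<open>z\<close>; the case of no open nodes is included.\<close>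

definition zero_gap :: "('n, 't, 'h) rolling \<Rightarrow> ('n, 't, 'h) tstate \<Rightarrow> ('n, 't, 'h) point \<Rightarrow> bool" where
  "zero_gap I s z \<longleftrightarrow> incumbent s = Some z \<and>
     ereal (cost I (px z)) \<le> (INF N \<in> open_nodes s. lower_bound I (pool s) N)"

definition optimal_ord :: "('n, 't, 'h) rolling \<Rightarrow> ('n, 'h) xvec \<Rightarrow> bool" where
  "optimal_ord I x \<longleftrightarrow> is_arg_min (cost I) (\<lambda>x. x \<in> Xord I) x"

definition optimal_full :: "('n, 't, 'h) rolling \<Rightarrow> ('n, 't, 'h) point \<Rightarrow> bool" where
  "optimal_full I z \<longleftrightarrow> is_arg_min (\<lambda>z. cost I (px z)) (\<lambda>z. z \<in> Pfull I) z"

end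

(*
  Certification is exact.  Flow conservation in the acyclic network lets a unit serve a trip at most
  once, and the family limits bound the number of units on trip k by qbar k; so the big-M constants
  make every inactive ordering row redundant, and a point of the full formulation is the same as a
  network solution with an element of Omega.  Order-linking makes the values theta on a trip distinct
  integers in {1..q}, that is, a permutation; hence Omega is nonempty iff the position problem is
  solvable, and rejected assignments are exactly the non-orderable ones.

  Therefore no cut removes a point of the full formulation, and every such point either does not beat
  the incumbent or lies in an open node; this gives optimality at zero gap.  Termination is
  lexicographic descent of (admissible cuts not yet in the pool, assignments cheaper than the
  incumbent, multiset of integer point counts of the open nodes).  A run cannot get stuck because a
  feasible node relaxation attains its minimum, by compactness of the box of all variable values.
*)

theory Submission
  imports Defs "HOL-Analysis.Function_Topology" "HOL-Library.Multiset"
begin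

section \<open>Finite sums of binary values, regrouping of sums, cyclic lists, finite function
  spaces\<close>

lemma binary_sum_eq_1:
  fixes g :: "'a \<Rightarrow> real"
  assumes "finite A" and g: "\<And>x. x \<in> A \<Longrightarrow> g x \<in> {0, 1}" and "sum g A = 1"
  shows "\<exists>a\<in>A. \<forall>x\<in>A. g x = (if x = a then 1 else 0)"
proof -
  have "\<exists>a\<in>A. g a \<noteq> 0"
    using assms(3) by (metis sum.neutral zero_neq_one)
  then obtain a where a: "a \<in> A" "g a = 1"
    using g by blast
  have "sum g (A - {a}) = 0"
    using assms a by (simp add: sum_diff1)
  moreover have "\<And>x. x \<in> A - {a} \<Longrightarrow> 0 \<le> g x"
    using g by fastforce
  ultimately have "\<forall>x\<in>A - {a}. g x = 0"
    using assms(1) by (metis finite_Diff sum_nonneg_eq_0_iff)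
  with a show ?thesis by auto
qed

lemma binary_sum_eq_card:
  fixes g :: "'a \<Rightarrow> real"
  assumes "finite A" and g: "\<And>x. x \<in> A \<Longrightarrow> g x \<in> {0, 1}"
  shows "sum g A = card {x \<in> A. g x = 1}"
proof -
  have "sum g A = (\<Sum>x\<in>A. if g x = 1 then 1 else 0)"
    using g by (intro sum.cong) fastforce+
  also have "\<dots> = card {x \<in> A. g x = 1}"
    using assms(1) by (simp add: sum.If_cases Int_def)
  finally show ?thesis .
qed

text \<open>Serves both to group arcs by an endpoint and to group units by type. Since
  \<open>g\<close> may map outside \<open>T\<close>, the domain is first cut down to the elements
  sent into \<open>T\<close>, where \<open>sum.group\<close> applies.\<close>

lemma sum_fibres:
  assumes "finite A" "finite T"
  shows "(\<Sum>y\<in>T. sum f {x \<in> A. g x = y}) = sum f {x \<in> A. g x \<in> T}"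
proof -
  have "(\<Sum>y\<in>T. sum f {x \<in> A. g x = y})
      = (\<Sum>y\<in>T. sum f {x \<in> {x \<in> A. g x \<in> T}. g x = y})"
    by (intro sum.cong refl) auto
  also have "\<dots> = sum f {x \<in> A. g x \<in> T}"
    using assms by (intro sum.group) auto
  finally show ?thesis .
qed

text \<open>A list entry with maximal value has no larger successor. This one argument refutes both
  precedence cycles and violated cycle inequalities.\<close>

lemma cyclic_increase_impossible:
  fixes f :: "'a \<Rightarrow> 'b::linorder"
  assumes "hs \<noteq> []" and inc: "\<And>r. r < length hs \<Longrightarrow> f (hs ! r) < f (hs ! (Suc r mod length hs))"
  shows False
proof -
  have "finite (f ` set hs)" "f ` set hs \<noteq> {}" using assms(1) by auto
  then have "Max (f ` set hs) \<in> f ` set hs" by (rule Max_in)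
  then obtain r where r: "r < length hs" "f (hs ! r) = Max (f ` set hs)"
    by (metis imageE in_set_conv_nth)
  have "hs ! (Suc r mod length hs) \<in> set hs"
    using assms(1) by simp
  then have "f (hs ! (Suc r mod length hs)) \<le> Max (f ` set hs)" by simp
  with inc[OF r(1)] r(2) show False by simp
qed

lemma cycle_edges_nth:
  assumes "r < length vs"
  shows "(vs ! r, vs ! (Suc r mod length vs)) \<in> cycle_edges vs"
  using assms unfolding cycle_edges_def by (auto simp: set_zip nth_rotate1 intro!: exI[of _ r])

lemma finite_dependent_functions:
  assumes "finite J" and "\<And>v. v \<in> J \<Longrightarrow> finite (B v)"
  shows "finite {f. \<forall>v. f v \<in> (if v \<in> J then B v else {d})}"
proof (rule finite_subset)
  show "finite {f. \<forall>v. (v \<in> J \<longrightarrow> f v \<in> \<Union> (B ` J)) \<and> (v \<notin> J \<longrightarrow> f v = d)}"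
    using assms by (intro finite_set_of_finite_funs) auto
qed (auto split: if_splits)

section \<open>Unit flows\<close>

locale valid_instance =
  fixes I :: "('n, 't, 'h) rolling"
  assumes inst: "rolling_instance I"
begin

lemma finite_trips: "finite (trips I)" and finite_types: "finite (types I)"
  and finite_units: "finite (units I)" and turn_trips: "turn I \<subseteq> trips I \<times> trips I"
  using inst by (auto simp: rolling_instance_def)

lemma finite_arcs: "finite (arcs I)"
  unfolding arcs_def using finite_trips turn_trips
  by (auto intro!: finite_imageI finite_subset[of "turn I"])

lemma uarcs_arcs: "h \<in> units I \<Longrightarrow> uarcs I h \<subseteq> arcs I"
  using inst by (auto simp: rolling_instance_def)

lemma finite_uarcs: "h \<in> units I \<Longrightarrow> finite (uarcs I h)"
  using uarcs_arcs finite_arcs finite_subset by metis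

lemma feasfam_types: "j \<in> trips I \<Longrightarrow> f \<in> feasfam I j \<Longrightarrow> f \<subseteq> types I"
proof -
  assume "j \<in> trips I" "f \<in> feasfam I j"
  moreover have "families I \<subseteq> Pow (types I)" "\<forall>j \<in> trips I. feasfam I j \<subseteq> families I"
    using inst by (simp_all add: rolling_instance_def)
  ultimately show ?thesis by auto
qed

lemma finite_feasfam: "j \<in> trips I \<Longrightarrow> finite (feasfam I j)"
  using feasfam_types finite_types by (meson Pow_iff finite_Pow_iff finite_subset subsetI)

lemma vlim_le_qbar: "j \<in> trips I \<Longrightarrow> f \<in> feasfam I j \<Longrightarrow> vlim I f \<le> qbar I j"
  unfolding qbar_def using finite_feasfam by auto

lemma qbar_pos: "j \<in> trips I \<Longrightarrow> 1 \<le> qbar I j"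
proof -
  assume j: "j \<in> trips I"
  have "\<forall>f \<in> families I. 1 \<le> vlim I f"
    "\<forall>j \<in> trips I. feasfam I j \<noteq> {} \<and> feasfam I j \<subseteq> families I"
    using inst by (simp_all add: rolling_instance_def)
  with j obtain f where "f \<in> feasfam I j" "1 \<le> vlim I f" by blast
  with vlim_le_qbar[OF j] show ?thesis by fastforce
qed

lemma dirn_cases: "i \<in> trips I \<Longrightarrow> dirn I i = -1 \<or> dirn I i = 1"
  using inst by (auto simp: rolling_instance_def)

lemma unit_turn_trips: "unit_turn I h i j \<Longrightarrow> i \<in> trips I \<and> j \<in> trips I"
  using turn_trips by (auto simp: unit_turn_def)

lemma x_dom_cases: "x_dom I x \<Longrightarrow> x h a = 0 \<or> x h a = 1"
  unfolding x_dom_def by (smt (verit) insertE singletonD)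

lemma x_nonneg: "x_dom I x \<Longrightarrow> 0 \<le> x h a" and x_le_1: "x_dom I x \<Longrightarrow> x h a \<le> 1"
  using x_dom_cases[of x h a] by auto

text \<open>
  The ancestors of a node in the acyclic network, together with the source, form a set that no arc
  enters; by conservation its outflow is that of the source, and it bounds the inflow of the node.
\<close>

lemma served_le_1:
  assumes x: "x_dom I x" and net: "network I x y" and h: "h \<in> units I" and i: "i \<in> trips I"
  shows "served I x i h \<le> 1"
proof -
  let ?A = "uarcs I h" and ?v = "Trip i"
  define T where "T = {j \<in> trips I. (Trip j, ?v) \<in> (uarcs I h)\<^sup>+}"
  define S where "S = insert Source (Trip ` T)"
  define B where "B = {a \<in> ?A. snd a \<in> Trip ` T}"
  have A: "?A \<subseteq> arcs I" "finite ?A"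
    using uarcs_arcs finite_uarcs h by auto
  have fT: "finite T" "finite S"
    using finite_trips by (auto simp: T_def S_def)
  note nonneg = x_nonneg[OF x, of h]
  have "acyclic ?A"
    using inst A(1) acyclic_subset by (auto simp: rolling_instance_def)
  then have v: "?v \<notin> Trip ` T"
    by (auto simp: T_def acyclic_def)
  have tail: "fst a \<in> S" if "a \<in> ?A" "snd a = ?v \<or> snd a \<in> Trip ` T" for a
  proof -
    have "(fst a, ?v) \<in> (uarcs I h)\<^sup>+"
      using that by (cases a) (auto simp: T_def intro: trancl_into_trancl2)
    moreover have "fst a = Source \<or> fst a \<in> Trip ` trips I"
      using subsetD[OF A(1) that(1)] turn_trips by (auto simp: arcs_def)
    ultimately show ?thesis by (auto simp: S_def T_def)
  qed
  have cons: "(\<Sum>a \<in> out_arcs I h (Trip j). x h a) = (\<Sum>a \<in> in_arcs I h (Trip j). x h a)"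
    if "j \<in> trips I" for j
    using net h that by (auto simp: network_def)
  have "(\<Sum>a \<in> {a \<in> ?A. fst a \<in> S}. x h a) = (\<Sum>w \<in> S. \<Sum>a \<in> out_arcs I h w. x h a)"
    using A(2) fT(2) by (simp add: out_arcs_def sum_fibres)
  also have "\<dots> = (\<Sum>a \<in> out_arcs I h Source. x h a) + (\<Sum>w \<in> Trip ` T. \<Sum>a \<in> out_arcs I h w. x h a)"
    unfolding S_def using fT(1) by (intro sum.insert) auto
  also have "(\<Sum>w \<in> Trip ` T. \<Sum>a \<in> out_arcs I h w. x h a)
      = (\<Sum>w \<in> Trip ` T. \<Sum>a \<in> in_arcs I h w. x h a)"
    by (rule sum.cong[OF refl]) (auto simp: T_def cons)
  also have "\<dots> = (\<Sum>a \<in> B. x h a)"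
    using A(2) fT(1) by (simp add: in_arcs_def B_def sum_fibres)
  finally have 1: "(\<Sum>a \<in> {a \<in> ?A. fst a \<in> S}. x h a)
      = (\<Sum>a \<in> out_arcs I h Source. x h a) + (\<Sum>a \<in> B. x h a)" .
  \<comment> \<open>Every arc entering \<open>T\<close> or \<open>?v\<close> leaves
    \<open>S\<close>, so the outflow of \<open>S\<close> is at least the flow on \<open>B\<close>
    plus the inflow of \<open>?v\<close>. By \<open>1\<close> it equals the source outflow plus the
    flow on \<open>B\<close>; cancelling bounds the inflow of \<open>?v\<close> by the source
    outflow.\<close>
  have "(\<Sum>a \<in> B \<union> in_arcs I h ?v. x h a) \<le> (\<Sum>a \<in> {a \<in> ?A. fst a \<in> S}. x h a)"
    using A tail nonneg by (intro sum_mono2) (auto simp: B_def in_arcs_def)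
  moreover have "(\<Sum>a \<in> B \<union> in_arcs I h ?v. x h a)
      = (\<Sum>a \<in> B. x h a) + (\<Sum>a \<in> in_arcs I h ?v. x h a)"
    using A v by (intro sum.union_disjoint) (auto simp: B_def in_arcs_def)
  moreover have "(\<Sum>a \<in> out_arcs I h Source. x h a) \<le> 1"
    using net h by (auto simp: network_def)
  ultimately show ?thesis
    using 1 cons[OF i] by (simp add: served_def)
qed

lemma served_cases:
  assumes x: "x \<in> Xnet I" and h: "h \<in> units I" and i: "i \<in> trips I"
  shows "served I x i h = 0 \<or> served I x i h = 1"
proof -
  obtain y where xy: "x_dom I x" "network I x y" using x by (auto simp: Xnet_def)
  have "served I x i h = card {a \<in> out_arcs I h (Trip i). x h a = 1}"
    unfolding served_def
  proof (rule binary_sum_eq_card)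
    show "finite (out_arcs I h (Trip i))" using finite_uarcs[OF h] by (auto simp: out_arcs_def)
    show "x h a \<in> {0, 1}" for a using x_dom_cases[OF xy(1)] by simp
  qed
  with served_le_1[OF xy h i] show ?thesis by (auto simp: le_Suc_eq)
qed

lemma served_eq: "x \<in> Xnet I \<Longrightarrow> h \<in> units I \<Longrightarrow> i \<in> trips I \<Longrightarrow>
    served I x i h = (if h \<in> U_set I x i then 1 else 0)"
  using served_cases[of x h i] by (auto simp: U_set_def)

lemma finite_U_set: "finite (U_set I x i)"
  using finite_units by (auto simp: U_set_def)

lemma qtot_eq_card:
  assumes "x \<in> Xnet I" "i \<in> trips I"
  shows "qtot I x i = card (U_set I x i)"
  unfolding qtot_def U_set_def
  using served_cases[OF assms(1) _ assms(2)] finite_units by (subst binary_sum_eq_card) auto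

text \<open>Exactly one family \<open>f\<close> is selected by \<open>y\<close>. A serving unit uses
  an arc at the trip, so its type lies in some feasible family \<open>g\<close>; the limit of
  \<open>g\<close> then needs \<open>y j g = 1\<close>, which forces \<open>g = f\<close>. Hence the
  single limit of \<open>f\<close> counts all serving units.\<close>

lemma card_U_set_le_qbar:
  assumes x: "x \<in> Xnet I" and j: "j \<in> trips I"
  shows "card (U_set I x j) \<le> qbar I j"
proof -
  obtain y where y: "y_dom I y" and net: "network I x y" using x by (auto simp: Xnet_def)
  have y01: "y j f \<in> {0, 1}" if "f \<in> feasfam I j" for f
    using y that j unfolding y_dom_def by (metis (full_types))
  have "(\<Sum>f \<in> feasfam I j. y j f) = 1" using net j by (auto simp: network_def)
  from binary_sum_eq_1[OF finite_feasfam[OF j] y01 this]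
  obtain f where f: "f \<in> feasfam I j" and yf: "\<forall>g\<in>feasfam I j. y j g = (if g = f then 1 else 0)"
    by blast
  have group: "(\<Sum>t \<in> g. \<Sum>h \<in> units_of I t. served I x j h)
      = (\<Sum>h \<in> {h \<in> units I. utype I h \<in> g}. served I x j h)" if "g \<in> feasfam I j" for g
    using finite_units finite_subset[OF feasfam_types[OF j that] finite_types]
    by (simp add: units_of_def sum_fibres)
  have lim: "(\<Sum>h \<in> {h \<in> units I. utype I h \<in> g}. served I x j h) \<le> vlim I g * y j g"
    if "g \<in> feasfam I j" for g
    using net j that unfolding group[OF that, symmetric] by (auto simp: network_def served_def)
  have nonneg: "0 \<le> served I x j h" if "h \<in> units I" for h
    using served_cases[OF x that j] by auto
  have "utype I h \<in> f" if h: "h \<in> U_set I x j" for h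
  proof -
    have hu: "h \<in> units I" "served I x j h = 1" using h by (auto simp: U_set_def)
    from hu(2) obtain a where a: "a \<in> uarcs I h" "fst a = Trip j"
      unfolding served_def out_arcs_def
      by (metis (mono_tags, lifting) empty_Collect_eq sum.empty zero_neq_one)
    have "\<forall>a \<in> uarcs I h. \<forall>j. fst a = Trip j \<or> snd a = Trip j \<longrightarrow>
        (\<exists>f \<in> feasfam I j. utype I h \<in> f)"
      using inst hu(1) by (simp add: rolling_instance_def)
    with a obtain g where g: "g \<in> feasfam I j" "utype I h \<in> g" by blast
    have "1 \<le> (\<Sum>h \<in> {h \<in> units I. utype I h \<in> g}. served I x j h)"
      using hu g finite_units nonneg
        member_le_sum[of h "{h \<in> units I. utype I h \<in> g}" "served I x j"] by auto
    with lim[OF g(1)] yf g have "g = f" by (auto split: if_splits)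
    with g show ?thesis by simp
  qed
  then have "U_set I x j \<subseteq> {h \<in> units I. utype I h \<in> f}"
    by (auto simp: U_set_def)
  then have "(\<Sum>h \<in> U_set I x j. served I x j h)
      \<le> (\<Sum>h \<in> {h \<in> units I. utype I h \<in> f}. served I x j h)"
    using finite_units nonneg by (intro sum_mono2) auto
  also have "\<dots> \<le> vlim I f"
    using lim[OF f] yf f by simp
  also have "(\<Sum>h \<in> U_set I x j. served I x j h) = card (U_set I x j)"
    by (simp add: U_set_def)
  finally show ?thesis
    using vlim_le_qbar[OF j f] by simp
qed

lemma U_set_if_leaves:
  assumes x: "x \<in> Xnet I" and h: "h \<in> units I" and j: "j \<in> trips I"
    and a: "(Trip j, w) \<in> uarcs I h" "x h (Trip j, w) = 1"
  shows "h \<in> U_set I x j"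
proof -
  have xd: "x_dom I x" using x by (auto simp: Xnet_def)
  have "x h (Trip j, w) \<le> served I x j h"
    unfolding served_def
  proof (rule member_le_sum)
    show "0 \<le> x h b" for b by (rule x_nonneg[OF xd])
  qed (use a finite_uarcs[OF h] in \<open>auto simp: out_arcs_def\<close>)
  with served_cases[OF x h j] a h show ?thesis by (auto simp: U_set_def)
qed

text \<open>Flow conservation turns a used incoming arc into outgoing flow, in terms of which
  \<open>served\<close> is defined.\<close>

lemma U_set_if_enters:
  assumes x: "x \<in> Xnet I" and h: "h \<in> units I" and j: "j \<in> trips I"
    and a: "(w, Trip j) \<in> uarcs I h" "x h (w, Trip j) = 1"
  shows "h \<in> U_set I x j"
proof -
  obtain y where xd: "x_dom I x" and net: "network I x y" using x by (auto simp: Xnet_def)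
  have "x h (w, Trip j) \<le> (\<Sum>a \<in> in_arcs I h (Trip j). x h a)"
  proof (rule member_le_sum)
    show "0 \<le> x h b" for b by (rule x_nonneg[OF xd])
  qed (use a finite_uarcs[OF h] in \<open>auto simp: in_arcs_def\<close>)
  also have "\<dots> = served I x j h"
    using net h j by (auto simp: network_def served_def)
  finally show ?thesis
    using served_cases[OF x h j] a h by (auto simp: U_set_def)
qed

section \<open>Ordering rows\<close>

text \<open>For binary \<open>x\<close> the value \<open>D\<close> is 0, 1 or 2, so an inactive row
  has at least one full big-M unit of slack.\<close>

lemma deact_cases:
  assumes x: "x_dom I x"
  shows "deact x r = 0 \<or> 1 \<le> deact x r"
  using x_dom_cases[OF x] by (cases r) (simp_all, (smt (verit))+)

text \<open>\<open>D = 0\<close> with entries at most 1 forces both arc variables to 1, so both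
  units serve \<open>k\<close>: their arcs enter \<open>k\<close> in a coupling and leave it in a
  decoupling. Precedence edges thus never touch units absent from the trip.\<close>

lemma active_forces:
  assumes x: "x \<in> Xnet I" and r: "r \<in> active I x" and f: "forces I r k a b"
  shows "k \<in> trips I \<and> a \<in> U_set I x k \<and> b \<in> U_set I x k \<and> a \<noteq> b"
proof -
  have xd: "x_dom I x" using x by (auto simp: Xnet_def)
  have two: "u = 1 \<and> v = 1" if "2 - u - v = 0" "u \<le> 1" "v \<le> 1" for u v :: real
    using that by linarith
  have ri: "ord_index I r" "deact x r = 0"
    using r by (auto simp: active_def ord_rows_def)
  show ?thesis
  proof (cases r)
    case (CplOpp i1 i2 j h1 h2)
    moreover have "x h1 (Trip i1, Trip j) = 1 \<and> x h2 (Trip i2, Trip j) = 1"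
      using ri CplOpp x_le_1[OF xd] by (intro two) auto
    ultimately show ?thesis
      using f ri U_set_if_enters[OF x, of h1 j "Trip i1"] U_set_if_enters[OF x, of h2 j "Trip i2"]
      by (auto simp: unit_turn_def dest: subsetD[OF turn_trips])
  next
    case (CplSame i1 i2 j h1 h2)
    moreover have "x h1 (Trip i1, Trip j) = 1 \<and> x h2 (Trip i2, Trip j) = 1"
      using ri CplSame x_le_1[OF xd] by (intro two) auto
    ultimately show ?thesis
      using f ri U_set_if_enters[OF x, of h1 j "Trip i1"] U_set_if_enters[OF x, of h2 j "Trip i2"]
      by (auto simp: unit_turn_def dest: subsetD[OF turn_trips])
  next
    case (DcpOpp i j1 j2 h1 h2)
    moreover have "x h1 (Trip i, Trip j1) = 1 \<and> x h2 (Trip i, Trip j2) = 1"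
      using ri DcpOpp x_le_1[OF xd] by (intro two) auto
    ultimately show ?thesis
      using f ri U_set_if_leaves[OF x, of h1 i "Trip j1"] U_set_if_leaves[OF x, of h2 i "Trip j2"]
      by (auto simp: unit_turn_def dest: subsetD[OF turn_trips])
  next
    case (DcpSame i j1 j2 h1 h2)
    moreover have "x h1 (Trip i, Trip j1) = 1 \<and> x h2 (Trip i, Trip j2) = 1"
      using ri DcpSame x_le_1[OF xd] by (intro two) auto
    ultimately show ?thesis
      using f ri U_set_if_leaves[OF x, of h1 i "Trip j1"] U_set_if_leaves[OF x, of h2 i "Trip j2"]
      by (auto simp: unit_turn_def dest: subsetD[OF turn_trips])
  next
    case (Cont i j h1 h2)
    with f show ?thesis by simp
  qed
qed

lemma active_Cont:
  assumes x: "x \<in> Xnet I" and r: "Cont i j h1 h2 \<in> active I x"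
  shows "i \<in> trips I" "j \<in> trips I" "{h1, h2} \<subseteq> U_set I x i" "{h1, h2} \<subseteq> U_set I x j"
proof -
  have xd: "x_dom I x" using x by (auto simp: Xnet_def)
  have ri: "h1 \<in> units I" "h2 \<in> units I" "unit_turn I h1 i j" "unit_turn I h2 i j"
    and "x h1 (Trip i, Trip j) + x h2 (Trip i, Trip j) = 2"
    using r by (auto simp: active_def ord_rows_def)
  then have x1: "x h1 (Trip i, Trip j) = 1" "x h2 (Trip i, Trip j) = 1"
    using x_le_1[OF xd, of h1] x_le_1[OF xd, of h2] by (smt (verit))+
  show ij: "i \<in> trips I" "j \<in> trips I"
    using unit_turn_trips[OF ri(3)] by auto
  show "{h1, h2} \<subseteq> U_set I x i" "{h1, h2} \<subseteq> U_set I x j"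
    using ri ij x1 U_set_if_leaves[OF x, of _ i "Trip j"] U_set_if_enters[OF x, of _ j "Trip i"]
    by (auto simp: unit_turn_def)
qed

text \<open>What a row demands of \<open>\<theta>\<close> once its big-M term has vanished. The
  precedence is only weak, as in the row itself; strictness comes later from the distinctness of
  positions. Rows with coefficient 0 force nothing.\<close>

definition row_required :: "('n, 'h) thvec \<Rightarrow> ('n, 'h) ordinst \<Rightarrow> bool" where
  "row_required \<theta> r \<longleftrightarrow> (\<forall>k a b. forces I r k a b \<longrightarrow> \<theta> k a \<le> \<theta> k b) \<and>
     (\<forall>i j h1 h2. r = Cont i j h1 h2 \<longrightarrow>
        \<theta> j h1 - \<theta> j h2 = dirn I i * dirn I j * (\<theta> i h1 - \<theta> i h2))"

lemma active_row_iff: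
  assumes "deact x r = 0"
  shows "ord_holds I x \<theta> r \<longleftrightarrow> row_required \<theta> r"
proof -
  have pos: "0 \<le> c * (u - v) \<longleftrightarrow> (0 < c \<longrightarrow> v \<le> u) \<and> (c < 0 \<longrightarrow> u \<le> v)" for c u v :: real
    by (auto simp: zero_le_mult_iff)
  have neg: "c * (u - v) \<le> 0 \<longleftrightarrow> (0 < c \<longrightarrow> u \<le> v) \<and> (c < 0 \<longrightarrow> v \<le> u)" for c u v :: real
    by (auto simp: mult_le_0_iff)
  show ?thesis
  proof (cases r)
    case (Cont i j h1 h2)
    then show ?thesis using assms by (auto simp: row_required_def)
  \<comment> \<open>\<open>ord_coef\<close> stays folded: the claim depends only on the sign of the
    coefficient, through \<open>pos\<close> for the lower-bound rows and \<open>neg\<close> for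
    \<open>DcpOpp\<close>.\<close>
  qed (use assms in \<open>simp only: ord_holds.simps row_required_def; simp add: pos neg del: ord_coef.simps; blast\<close>)+
qed

text \<open>Two values in \<open>{0..qbar}\<close> differ by at most \<open>qbar\<close>, so each
  big-M constant dominates its left-hand side as soon as \<open>D\<close> is at least 1. The
  coefficient is bounded by 2 in the opposite-direction rows and by its own modulus in the
  others.\<close>

lemma inactive_row_holds:
  fixes \<theta> :: "('n, 'h) thvec"
  assumes r: "r \<in> ord_rows I" and D: "1 \<le> deact x r"
    and \<theta>: "\<And>i h. i \<in> trips I \<Longrightarrow> h \<in> units I \<Longrightarrow> 0 \<le> \<theta> i h \<and> \<theta> i h \<le> qbar I i"
  shows "ord_holds I x \<theta> r"
proof -
  have ri: "ord_index I r" using r by (auto simp: ord_rows_def)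
  have diff: "\<bar>\<theta> i h1 - \<theta> i h2\<bar> \<le> qbar I i" if "i \<in> trips I" "h1 \<in> units I" "h2 \<in> units I" for i h1 h2
    using \<theta>[OF that(1,2)] \<theta>[OF that(1,3)] by linarith
  have bound: "\<bar>c * (\<theta> i h1 - \<theta> i h2)\<bar> \<le> m * qbar I i * deact x r"
    if "i \<in> trips I" "h1 \<in> units I" "h2 \<in> units I" "\<bar>c\<bar> \<le> m"
    for c m :: real and i h1 h2
  proof -
    have "\<bar>c * (\<theta> i h1 - \<theta> i h2)\<bar> \<le> m * qbar I i"
      unfolding abs_mult using that diff[OF that(1-3)] by (intro mult_mono) auto
    also have "\<dots> = m * qbar I i * 1" by simp
    also have "\<dots> \<le> m * qbar I i * deact x r"
      using that D by (intro mult_left_mono) (auto intro!: mult_nonneg_nonneg)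
    finally show ?thesis .
  qed
  have opp: "\<bar>dirn I i * (dirn I j - dirn I k)\<bar> \<le> 2"
    if "i \<in> trips I" "j \<in> trips I" "k \<in> trips I" for i j k
    using dirn_cases[OF that(1)] dirn_cases[OF that(2)] dirn_cases[OF that(3)] by auto
  show ?thesis
  proof (cases r)
    case (CplOpp i1 i2 j h1 h2)
    then have "\<bar>ord_coef I r * (\<theta> j h1 - \<theta> j h2)\<bar> \<le> 2 * real (qbar I j) * deact x r"
      using ri opp unit_turn_trips by (intro bound) auto
    then show ?thesis unfolding CplOpp ord_holds.simps by linarith
  next
    case (CplSame i1 i2 j h1 h2)
    then have "\<bar>ord_coef I r * (\<theta> j h1 - \<theta> j h2)\<bar> \<le> \<bar>ord_coef I r\<bar> * qbar I j * deact x r"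
      using ri unit_turn_trips by (intro bound) auto
    then show ?thesis unfolding CplSame ord_holds.simps by (simp only: abs_le_iff) linarith
  next
    case (DcpOpp i j1 j2 h1 h2)
    then have "\<bar>ord_coef I r * (\<theta> i h1 - \<theta> i h2)\<bar> \<le> 2 * real (qbar I i) * deact x r"
      using ri opp unit_turn_trips by (intro bound) auto
    then show ?thesis unfolding DcpOpp ord_holds.simps by linarith
  next
    case (DcpSame i j1 j2 h1 h2)
    then have "\<bar>ord_coef I r * (\<theta> i h1 - \<theta> i h2)\<bar> \<le> \<bar>ord_coef I r\<bar> * qbar I i * deact x r"
      using ri unit_turn_trips by (intro bound) auto
    then show ?thesis unfolding DcpSame ord_holds.simps by (simp only: abs_le_iff) linarith
  next
    case (Cont i j h1 h2)
    then have ij: "i \<in> trips I" "j \<in> trips I" "h1 \<in> units I" "h2 \<in> units I"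
      using ri unit_turn_trips by auto
    let ?e = "(\<theta> j h1 - \<theta> j h2) - dirn I i * dirn I j * (\<theta> i h1 - \<theta> i h2)"
    \<comment> \<open>The direction product is 1 or -1, so the modulus is at most
      \<open>qbar I i + qbar I j\<close>, hence at most twice the larger one.\<close>
    have "\<bar>?e\<bar> \<le> Mcont I i j * 1"
      using dirn_cases[OF ij(1)] dirn_cases[OF ij(2)] diff[OF ij(1,3,4)] diff[OF ij(2,3,4)]
      by (auto simp: Mcont_def)
    also have "\<dots> \<le> Mcont I i j * deact x r"
      using D by (intro mult_left_mono) (auto simp: Mcont_def)
    finally show ?thesis unfolding Cont ord_holds.simps by linarith
  qed
qed

lemma th_dom_bounds:
  "th_dom I \<theta> \<Longrightarrow> i \<in> trips I \<Longrightarrow> h \<in> units I \<Longrightarrow> 0 \<le> \<theta> i h \<and> \<theta> i h \<le> qbar I i"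
  unfolding th_dom_def by (smt (verit) atLeastAtMost_iff imageE of_nat_0_le_iff of_nat_le_iff)

text \<open>\<open>Omega\<close> imposes only the active rows; the remaining ones hold automatically
  by \<open>inactive_row_holds\<close>.\<close>

lemma Pfull_iff:
  "z \<in> Pfull I \<longleftrightarrow> x_dom I (px z) \<and> y_dom I (py z) \<and> network I (px z) (py z) \<and>
     (pth z, pu z) \<in> Omega I (px z)"
proof -
  have "(\<forall>r \<in> active I (px z). ord_holds I (px z) (pth z) r) \<longleftrightarrow>
      (\<forall>r \<in> ord_rows I. ord_holds I (px z) (pth z) r)" if "x_dom I (px z)" "th_dom I (pth z)"
    using deact_cases[OF that(1)] inactive_row_holds th_dom_bounds[OF that(2)]
    unfolding active_def by blast
  then show ?thesis unfolding Pfull_def Omega_def by auto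
qed

lemma Xord_eq: "Xord I = px ` Pfull I"
proof
  show "Xord I \<subseteq> px ` Pfull I"
  proof
    fix x assume "x \<in> Xord I"
    then obtain y \<theta> u where "x_dom I x" "y_dom I y" "network I x y" "(\<theta>, u) \<in> Omega I x"
      by (auto simp: Xord_def Xnet_def)
    then have "\<lparr>px = x, py = y, pth = \<theta>, pu = u\<rparr> \<in> Pfull I"
      by (simp add: Pfull_iff)
    then show "x \<in> px ` Pfull I" by (rule rev_image_eqI) simp
  qed
qed (auto simp: Pfull_iff Xord_def Xnet_def)

section \<open>Certification\<close>

text \<open>When both units serve the trip, the term \<open>2 - s - s\<close> is 0. Then
  \<open>u = 0\<close> makes the upper bound -1 and \<open>u = 1\<close> makes the lower bound
  1.\<close>

lemma order_linking_increase:
  assumes lin: "order_linking I x \<theta> u" and k: "k \<in> trips I"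
    and a: "a \<in> U_set I x k" and b: "b \<in> U_set I x k" and ab: "a \<noteq> b"
  shows "u k a b = 0 \<Longrightarrow> \<theta> k a < \<theta> k b" and "u k a b = 1 \<Longrightarrow> \<theta> k b < \<theta> k a"
proof -
  have un: "a \<in> units I" "b \<in> units I" and s: "served I x k a = 1" "served I x k b = 1"
    using a b by (auto simp: U_set_def)
  have "1 - real (qbar I k) * (1 - u k a b)
          - real (qbar I k) * (2 - served I x k a - served I x k b) \<le> \<theta> k a - \<theta> k b \<and>
        \<theta> k a - \<theta> k b \<le> real (qbar I k) * u k a b - 1
          + real (qbar I k) * (2 - served I x k a - served I x k b)"
    using lin k un ab unfolding order_linking_def by blast
  then show "u k a b = 0 \<Longrightarrow> \<theta> k a < \<theta> k b" "u k a b = 1 \<Longrightarrow> \<theta> k b < \<theta> k a"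
    using s by auto
qed

lemma u_dom_cases:
  "u_dom I u \<Longrightarrow> u k a b = 0 \<or> u k a b = 1"
  unfolding u_dom_def by (smt (verit) insertE singletonD)

text \<open>Binary entries with unit row and column sums form a permutation matrix: row sums define
  \<open>f\<close>, column sums make it injective, and counting makes it onto.\<close>

lemma position_bijection:
  assumes sys: "position_system I x S lam" and k: "k \<in> trips I"
  shows "\<exists>f. bij_betw f (U_set I x k) {1..card (U_set I x k)} \<and>
    (\<forall>h \<in> U_set I x k. position I x lam k h = real (f h))"
proof -
  let ?U = "U_set I x k" and ?R = "{1..card (U_set I x k)}"
  have lam01: "lam k h r \<in> {0, 1}" if "h \<in> ?U" "r \<in> ?R" for h r
    using sys k that by (auto simp: position_system_def)
  have row: "(\<Sum>r\<in>?R. lam k h r) = 1" if "h \<in> ?U" for h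
    using sys k that by (auto simp: position_system_def)
  have col: "(\<Sum>h\<in>?U. lam k h r) = 1" if "r \<in> ?R" for r
    using sys k that unfolding position_system_def by blast
  have "\<exists>s\<in>?R. \<forall>r\<in>?R. lam k h r = (if r = s then 1 else 0)" if "h \<in> ?U" for h
    using lam01 row that by (intro binary_sum_eq_1) auto
  then obtain f where f: "\<And>h. h \<in> ?U \<Longrightarrow> f h \<in> ?R"
    "\<And>h r. h \<in> ?U \<Longrightarrow> r \<in> ?R \<Longrightarrow> lam k h r = (if r = f h then 1 else 0)"
    by metis
  have "inj_on f ?U"
  proof (rule inj_onI)
    fix a b assume ab: "a \<in> ?U" "b \<in> ?U" "f a = f b"
    have "\<exists>c\<in>?U. \<forall>h\<in>?U. lam k h (f a) = (if h = c then 1 else 0)"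
      by (rule binary_sum_eq_1[OF finite_U_set lam01 col]) (use f(1)[OF ab(1)] in simp_all)
    then obtain c where "\<forall>h\<in>?U. lam k h (f a) = (if h = c then 1 else 0)" ..
    with ab(1,2) ab(3)[symmetric] f show "a = b"
      by (metis zero_neq_one)
  qed
  moreover have "f ` ?U = ?R"
    using f(1) card_image[OF \<open>inj_on f ?U\<close>] by (intro card_subset_eq) auto
  ultimately have "bij_betw f ?U ?R" by (simp add: bij_betw_def)
  moreover have "position I x lam k h = real (f h)" if "h \<in> ?U" for h
  proof -
    have "position I x lam k h = (\<Sum>r\<in>?R. if r = f h then real r else 0)"
      unfolding position_def using f(2)[OF that] by (intro sum.cong) auto
    also have "\<dots> = real (f h)" using f(1)[OF that] by simp
    finally show ?thesis .
  qed
  ultimately show ?thesis by blast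
qed

text \<open>Soundness of acceptance. Positions are distinct integers from 1 to the number of serving
  units, which is at most \<open>qbar\<close>, so they fit the domains and leave \<open>u\<close>
  determined by comparison.\<close>

lemma witness_in_Omega:
  assumes x: "x \<in> Xnet I" and sys: "position_system I x (active I x) lam"
  defines "\<theta> \<equiv> witness_th I x lam"
  shows "(\<theta>, witness_u I \<theta>) \<in> Omega I x"
proof -
  let ?u = "witness_u I \<theta>"
  have val: "\<exists>n::nat. \<theta> k h = n \<and> 1 \<le> n \<and> n \<le> card (U_set I x k)"
    if k: "k \<in> trips I" and h: "h \<in> U_set I x k" for k h
  proof -
    obtain f where f: "bij_betw f (U_set I x k) {1..card (U_set I x k)}"
      "\<And>h. h \<in> U_set I x k \<Longrightarrow> position I x lam k h = real (f h)"
      using position_bijection[OF sys k] by blast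
    have "f h \<in> {1..card (U_set I x k)}"
      using f(1) h by (auto simp: bij_betw_def)
    with f(2)[OF h] k h show ?thesis by (auto simp: \<theta>_def witness_th_def)
  qed
  have distinct: "\<theta> k a + 1 \<le> \<theta> k b \<or> \<theta> k b + 1 \<le> \<theta> k a"
    if k: "k \<in> trips I" and ab: "a \<in> U_set I x k" "b \<in> U_set I x k" "a \<noteq> b" for k a b
  proof -
    obtain f where f: "bij_betw f (U_set I x k) {1..card (U_set I x k)}"
      "\<And>h. h \<in> U_set I x k \<Longrightarrow> position I x lam k h = real (f h)"
      using position_bijection[OF sys k] by blast
    have "f a \<noteq> f b"
      using f(1) ab by (auto simp: bij_betw_def inj_on_def)
    then have "real (f a) + 1 \<le> real (f b) \<or> real (f b) + 1 \<le> real (f a)" by linarith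
    with f(2) ab k show ?thesis by (simp add: \<theta>_def witness_th_def)
  qed
  have zero: "\<theta> k h = 0" if "h \<notin> U_set I x k \<or> k \<notin> trips I" for k h
    using that by (auto simp: \<theta>_def witness_th_def)
  have bounds: "1 \<le> \<theta> k h \<and> \<theta> k h \<le> card (U_set I x k) \<and> \<theta> k h \<le> qbar I k"
    if k: "k \<in> trips I" and h: "h \<in> U_set I x k" for k h
    using val[OF k h] card_U_set_le_qbar[OF x k] by force
  have "th_dom I \<theta>"
    unfolding th_dom_def
  proof (intro allI)
    fix k h
    show "\<theta> k h \<in> (if k \<in> trips I \<and> h \<in> units I then of_nat ` {0..qbar I k} else {0})"
    proof (cases "k \<in> trips I \<and> h \<in> U_set I x k")
      case True
      then obtain n where "\<theta> k h = real n" "n \<le> qbar I k"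
        using val[of k h] card_U_set_le_qbar[OF x, of k] by fastforce
      with True show ?thesis by (auto simp: U_set_def)
    qed (auto simp: zero image_iff)
  qed
  moreover have "u_dom I ?u"
    by (auto simp: u_dom_def witness_u_def)
  moreover have "order_linking I x \<theta> ?u"
    unfolding order_linking_def
  proof (intro conjI ballI impI)
    fix k h assume k: "k \<in> trips I" and h: "h \<in> units I"
    show "served I x k h \<le> \<theta> k h" "\<theta> k h \<le> qtot I x k"
      "\<theta> k h \<le> real (qbar I k) * served I x k h"
      using bounds[OF k, of h] zero[of h k] served_eq[OF x h k] qtot_eq_card[OF x k]
      by (cases "h \<in> U_set I x k"; simp)+
  next
    fix k a b assume k: "k \<in> trips I" and un: "a \<in> units I" "b \<in> units I" and ab: "a \<noteq> b"
    have u: "?u k a b = (if \<theta> k b < \<theta> k a then 1 else 0)"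
      using k un ab by (simp add: witness_u_def)
    have q: "1 \<le> real (qbar I k)" using qbar_pos[OF k] by simp
    \<comment> \<open>Two serving units have distinct values in \<open>{1..qbar}\<close>, so their
      difference has modulus between 1 and \<open>qbar - 1\<close>, exactly what the inequalities
      allow without slack. If a unit does not serve the trip, its value is 0 and the slack of at
      least \<open>qbar\<close>, itself at least 1, suffices.\<close>
    show "1 - real (qbar I k) * (1 - ?u k a b)
          - real (qbar I k) * (2 - served I x k a - served I x k b) \<le> \<theta> k a - \<theta> k b"
      "\<theta> k a - \<theta> k b \<le> real (qbar I k) * ?u k a b - 1
          + real (qbar I k) * (2 - served I x k a - served I x k b)"
      unfolding u served_eq[OF x un(1) k] served_eq[OF x un(2) k]
      using bounds[OF k, of a] bounds[OF k, of b] zero[of a k] zero[of b k] distinct[OF k _ _ ab] q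
      by (cases "a \<in> U_set I x k"; cases "b \<in> U_set I x k"; force)+
  qed
  moreover have "ord_holds I x \<theta> r" if r: "r \<in> active I x" for r
  proof -
    have "row_required \<theta> r"
      unfolding row_required_def
    proof (intro conjI allI impI)
      fix k a b assume f: "forces I r k a b"
      note U = active_forces[OF x r f]
      have "(a, b) \<in> prec_edges I (active I x) k"
        using r f by (auto simp: prec_edges_def)
      then have "position I x lam k a + 1 \<le> position I x lam k b"
        using sys U unfolding position_system_def by blast
      with U show "\<theta> k a \<le> \<theta> k b" by (simp add: \<theta>_def witness_th_def)
    next
      fix i j h1 h2 assume "r = Cont i j h1 h2"
      then have c: "Cont i j h1 h2 \<in> active I x" using r by simp
      then have "position I x lam j h1 - position I x lam j h2
          = dirn I i * dirn I j * (position I x lam i h1 - position I x lam i h2)"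
        using sys unfolding position_system_def by blast
      with active_Cont[OF x c]
      show "\<theta> j h1 - \<theta> j h2 = dirn I i * dirn I j * (\<theta> i h1 - \<theta> i h2)"
        by (simp add: \<theta>_def witness_th_def)
    qed
    with r active_row_iff[of x r \<theta>] show ?thesis by (simp add: active_def)
  qed
  ultimately show ?thesis by (auto simp: Omega_def)
qed

section \<open>From an element of \<open>Omega\<close> back to the position problem\<close>

lemma Omega_required:
  assumes "(\<theta>, u) \<in> Omega I x" "r \<in> active I x"
  shows "row_required \<theta> r"
  using assms active_row_iff[of x r \<theta>] by (auto simp: Omega_def active_def)

lemma Omega_distinct:
  assumes \<Omega>: "(\<theta>, u) \<in> Omega I x" and k: "k \<in> trips I"
    and ab: "a \<in> U_set I x k" "b \<in> U_set I x k" "a \<noteq> b"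
  shows "\<theta> k a \<noteq> \<theta> k b"
proof -
  have "order_linking I x \<theta> u" "u_dom I u" using \<Omega> by (auto simp: Omega_def)
  then show ?thesis
    using order_linking_increase[of x \<theta> u k a b] u_dom_cases[of u k a b] k ab by force
qed

text \<open>The active row yields only the weak inequality; \<open>Omega_distinct\<close> makes it
  strict.\<close>

lemma Omega_increasing:
  assumes x: "x \<in> Xnet I" and \<Omega>: "(\<theta>, u) \<in> Omega I x"
    and e: "(a, b) \<in> prec_edges I (active I x) k"
  shows "\<theta> k a < \<theta> k b"
proof -
  obtain r where r: "r \<in> active I x" "forces I r k a b"
    using e by (auto simp: prec_edges_def)
  note U = active_forces[OF x r]
  have "\<theta> k a \<le> \<theta> k b"
    using Omega_required[OF \<Omega> r(1)] r(2) by (auto simp: row_required_def)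
  with Omega_distinct[OF \<Omega>, of k a b] U show ?thesis by auto
qed

lemma Omega_acyclic:
  assumes x: "x \<in> Xnet I" and \<Omega>: "(\<theta>, u) \<in> Omega I x"
  shows "\<not> dicycle V (prec_edges I (active I x) k) vs"
proof
  assume d: "dicycle V (prec_edges I (active I x) k) vs"
  have "\<theta> k (vs ! r) < \<theta> k (vs ! (Suc r mod length vs))" if "r < length vs" for r
    using Omega_increasing[OF x \<Omega>] cycle_edges_nth[OF that] d by (auto simp: dicycle_def)
  with d show False
    using cyclic_increase_impossible[of vs "\<theta> k"] by (auto simp: dicycle_def)
qed

text \<open>Converse of \<open>witness_in_Omega\<close>. Order-linking places the integral
  \<open>\<theta>\<close> of serving units between 1 and their number, and they are distinct; hence
  they are already a permutation, whose matrix solves the position problem.\<close>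

lemma Omega_position_system:
  assumes x: "x \<in> Xnet I" and \<Omega>: "(\<theta>, u) \<in> Omega I x"
  shows "\<exists>lam. position_system I x (active I x) lam"
proof -
  define lam :: "'n \<Rightarrow> 'h \<Rightarrow> nat \<Rightarrow> real" where "lam k h r = (if \<theta> k h = real r then 1 else 0)" for k h r
  have lin: "order_linking I x \<theta> u" and th: "th_dom I \<theta>" using \<Omega> by (auto simp: Omega_def)
  have val: "\<exists>n \<in> {1..card (U_set I x k)}. \<theta> k h = real n"
    if k: "k \<in> trips I" and h: "h \<in> U_set I x k" for k h
  proof -
    have hu: "h \<in> units I" and s: "served I x k h = 1" using h by (auto simp: U_set_def)
    have "\<theta> k h \<in> of_nat ` {0..qbar I k}"
      using th k hu unfolding th_dom_def by metis
    then obtain n where n: "\<theta> k h = real n" by auto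
    moreover have "1 \<le> \<theta> k h" "\<theta> k h \<le> card (U_set I x k)"
      using lin k hu s qtot_eq_card[OF x k] unfolding order_linking_def by (metis)+
    ultimately show ?thesis by auto
  qed
  have bij: "bij_betw (\<theta> k) (U_set I x k) (real ` {1..card (U_set I x k)})" if k: "k \<in> trips I" for k
  proof -
    have "inj_on (\<theta> k) (U_set I x k)"
      using Omega_distinct[OF \<Omega> k] by (auto simp: inj_on_def)
    moreover have "\<theta> k ` U_set I x k = real ` {1..card (U_set I x k)}"
      using val[OF k] card_image[OF \<open>inj_on (\<theta> k) (U_set I x k)\<close>]
      by (intro card_subset_eq) (auto simp: card_image)
    ultimately show ?thesis by (simp add: bij_betw_def)
  qed
  have position: "position I x lam k h = \<theta> k h" and
    row: "(\<Sum>r = 1..card (U_set I x k). lam k h r) = 1"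
    if kh: "k \<in> trips I" "h \<in> U_set I x k" for k h
  proof -
    obtain n where n: "n \<in> {1..card (U_set I x k)}" "\<theta> k h = real n" using val kh by blast
    then have lam: "lam k h = (\<lambda>r. if r = n then 1 else 0)" by (auto simp: lam_def)
    show "position I x lam k h = \<theta> k h" "(\<Sum>r = 1..card (U_set I x k). lam k h r) = 1"
      using n by (auto simp: position_def lam if_distrib cong: if_cong)
  qed
  have col: "(\<Sum>h \<in> U_set I x k. lam k h r) = 1"
    if k: "k \<in> trips I" and r: "r \<in> {1..card (U_set I x k)}" for k r
  proof -
    obtain a where a: "a \<in> U_set I x k" "\<theta> k a = real r"
      using bij[OF k] r by (metis bij_betw_imp_surj_on image_iff)
    have "\<theta> k h = real r \<longleftrightarrow> h = a" if "h \<in> U_set I x k" for h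
      using Omega_distinct[OF \<Omega> k that a(1)] a(2) by auto
    then have "(\<Sum>h \<in> U_set I x k. lam k h r) = (\<Sum>h \<in> U_set I x k. if h = a then 1 else 0)"
      by (intro sum.cong refl) (simp add: lam_def)
    with a finite_U_set show ?thesis by simp
  qed
  have "position_system I x (active I x) lam"
    unfolding position_system_def
  proof (intro conjI ballI allI impI)
    show "lam k h r \<in> {0, 1}" for k h r by (simp add: lam_def)
  next
    fix k e assume k: "k \<in> trips I" and e: "e \<in> prec_edges I (active I x) k"
    obtain a b where ab: "e = (a, b)" by fastforce
    obtain r where r: "r \<in> active I x" "forces I r k a b"
      using e ab by (auto simp: prec_edges_def)
    note U = active_forces[OF x r]
    obtain m n where "\<theta> k a = real m" "\<theta> k b = real n"
      using val U by metis
    \<comment> \<open>Integrality upgrades the strict inequality to the gap of 1 in the position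
      system.\<close>
    with Omega_increasing[OF x \<Omega> e[unfolded ab]] have "\<theta> k a + 1 \<le> \<theta> k b" by simp
    with U position ab show
      "case e of (a, b) \<Rightarrow> position I x lam k a + 1 \<le> position I x lam k b" by simp
  next
    fix i j h1 h2 assume c: "Cont i j h1 h2 \<in> active I x"
    have "\<theta> j h1 - \<theta> j h2 = dirn I i * dirn I j * (\<theta> i h1 - \<theta> i h2)"
      using Omega_required[OF \<Omega> c] by (auto simp: row_required_def)
    with active_Cont[OF x c] position
    show "position I x lam j h1 - position I x lam j h2
          = dirn I i * dirn I j * (position I x lam i h1 - position I x lam i h2)" by simp
  qed (use row col in auto)
  then show ?thesis by blast
qed

lemma accept_in_Omega:
  "x \<in> Xnet I \<Longrightarrow> certifies I x (Accept \<theta> u) \<Longrightarrow> (\<theta>, u) \<in> Omega I x"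
  by (auto elim!: certifies.cases intro: witness_in_Omega)

text \<open>An element of \<open>Omega\<close> would rule out both grounds for rejection: it
  increases along precedence edges and it solves the position problem. This is what makes exclusion
  cuts safe.\<close>

lemma reject_not_orderable:
  assumes x: "x \<in> Xnet I" and c: "certifies I x (Reject S)"
  shows "x \<notin> Xord I"
proof
  assume "x \<in> Xord I"
  then obtain \<theta> u where \<Omega>: "(\<theta>, u) \<in> Omega I x" by (auto simp: Xord_def)
  from c show False
    using Omega_acyclic[OF x \<Omega>] Omega_position_system[OF x \<Omega>] by cases auto
qed

lemma reject_active: "certifies I x (Reject S) \<Longrightarrow> S \<subseteq> active I x"
  by (auto elim: certifies.cases)

text \<open>Ensures that a candidate can always be processed. The returned subsystem is chosen as
  large as possible: all active rows generating an edge of the cycle, or all active rows.\<close>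

lemma certification_total: "\<exists>v. certifies I x v"
proof (cases "\<exists>k \<in> trips I. \<exists>vs. dicycle (U_set I x k) (prec_edges I (active I x) k) vs")
  case True
  then obtain k vs where k: "k \<in> trips I"
    and d: "dicycle (U_set I x k) (prec_edges I (active I x) k) vs" by blast
  define S where "S = {r \<in> active I x. \<exists>(a, b) \<in> cycle_edges vs. forces I r k a b}"
  have "cycle_edges vs \<subseteq> prec_edges I S k"
    using d by (fastforce simp: dicycle_def prec_edges_def S_def)
  then have "certifies I x (Reject S)"
    by (intro reject_cycle[OF k d]) (simp_all add: S_def)
  then show ?thesis by blast
next
  case False
  then have acyclic: "\<forall>k \<in> trips I. \<nexists>vs. dicycle (U_set I x k) (prec_edges I (active I x) k) vs"
    by blast
  show ?thesis
  proof (cases "\<exists>lam. position_system I x (active I x) lam")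
    case True
    then obtain lam where "position_system I x (active I x) lam" by blast
    from accept[OF acyclic this] show ?thesis by blast
  next
    case False
    from reject_infeasible[OF acyclic this subset_refl False] show ?thesis by blast
  qed
qed

section \<open>Finiteness and attainment\<close>

lemma val_inject: "val p = val q \<longleftrightarrow> p = (q :: ('n, 't, 'h) point)"
proof
  assume eq: "val p = val q"
  have "px p = px q" "py p = py q" "pth p = pth q" "pu p = pu q"
    using eq[THEN fun_cong, of "VX _ _"] eq[THEN fun_cong, of "VY _ _"]
      eq[THEN fun_cong, of "VT _ _"] eq[THEN fun_cong, of "VU _ _ _"]
    by (auto intro!: ext)
  then show "p = q" by simp
qed simp

text \<open>Inverse of \<open>val\<close>. Viewing points as functions on variables makes the
  product topology and counting of functions available.\<close>

definition point_of :: "(('n, 't, 'h) var \<Rightarrow> real) \<Rightarrow> ('n, 't, 'h) point" where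
  "point_of v = \<lparr>px = (\<lambda>h a. v (VX h a)), py = (\<lambda>j f. v (VY j f)),
     pth = (\<lambda>i h. v (VT i h)), pu = (\<lambda>i a b. v (VU i a b))\<rparr>"

lemma point_of_sel [simp]:
  "px (point_of v) = (\<lambda>h a. v (VX h a))" "py (point_of v) = (\<lambda>j f. v (VY j f))"
  "pth (point_of v) = (\<lambda>i h. v (VT i h))" "pu (point_of v) = (\<lambda>i a b. v (VU i a b))"
  by (simp_all add: point_of_def)

lemma val_point_of [simp]: "val (point_of v) w = v w"
  by (cases w) simp_all

lemma point_of_val [simp]: "point_of (val p) = p"
  by (simp add: point_of_def)

definition integer_points :: "('n, 't, 'h) point set" where
  "integer_points = {p. x_dom I (px p) \<and> y_dom I (py p) \<and> th_dom I (pth p) \<and> u_dom I (pu p)}"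

text \<open>One uniform description of the four domains: a natural number up to
  \<open>var_ub\<close>. The bound 0 off the index sets expresses vanishing there.\<close>

lemma integer_points_iff:
  "p \<in> integer_points \<longleftrightarrow> (\<forall>v. val p v \<in> real ` {n. real n \<le> var_ub I v})"
proof -
  have binary: "w \<in> real ` {n. real n \<le> (if b then 1 else 0)} \<longleftrightarrow> w \<in> (if b then {0, 1} else {0})"
    for w :: real and b
    by (auto simp: le_Suc_eq image_iff)
  have ranged: "w \<in> real ` {n. real n \<le> (if b then real m else 0)} \<longleftrightarrow>
      w \<in> (if b then of_nat ` {0..m} else {0})" for w :: real and b m
    by (auto simp: image_iff)
  have all_var: "(\<forall>v. Q v) \<longleftrightarrow> (\<forall>h a. Q (VX h a)) \<and> (\<forall>j f. Q (VY j f)) \<and>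
      (\<forall>i h. Q (VT i h)) \<and> (\<forall>i a b. Q (VU i a b))" for Q :: "('n, 't, 'h) var \<Rightarrow> bool"
    by (metis var.exhaust)
  show ?thesis
    unfolding all_var integer_points_def x_dom_def y_dom_def th_dom_def u_dom_def
    by (simp only: val.simps var_ub.simps binary ranged mem_Collect_eq)
qed

lemma finite_variables: "finite {v. var_ub I v \<noteq> 0}"
proof (rule finite_subset)
  let ?X = "(\<lambda>(h, a). VX h a) ` Sigma (units I) (uarcs I)"
  let ?Y = "(\<lambda>(j, f). VY j f) ` Sigma (trips I) (feasfam I)"
  let ?T = "(\<lambda>(i, h). VT i h) ` (trips I \<times> units I)"
  let ?U = "(\<lambda>(i, a, b). VU i a b) ` (trips I \<times> units I \<times> units I)"
  show "{v. var_ub I v \<noteq> 0} \<subseteq> ?X \<union> ?Y \<union> ?T \<union> ?U"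
  proof
    fix v assume "v \<in> {v. var_ub I v \<noteq> 0}"
    then show "v \<in> ?X \<union> ?Y \<union> ?T \<union> ?U"
      by (cases v) (auto split: if_splits simp: image_iff)
  qed
  show "finite (?X \<union> ?Y \<union> ?T \<union> ?U)"
    using finite_units finite_trips finite_uarcs finite_feasfam
    by (intro finite_UnI finite_imageI finite_SigmaI finite_cartesian_product) auto
qed

lemma finite_integer_points: "finite integer_points"
proof -
  let ?J = "{v. var_ub I v \<noteq> 0}" and ?B = "\<lambda>v. real ` {n. real n \<le> var_ub I v}"
  have fin: "finite (?B v)" for v
  proof -
    have "{n. real n \<le> var_ub I v} \<subseteq> {..nat \<lfloor>var_ub I v\<rfloor>}"
      by (auto simp: le_nat_floor)
    then show ?thesis using finite_subset by blast
  qed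
  have "val ` integer_points \<subseteq> {f. \<forall>v. f v \<in> (if v \<in> ?J then ?B v else {0})}"
  proof
    fix f assume "f \<in> val ` integer_points"
    then have B: "f v \<in> ?B v" for v by (auto simp: integer_points_iff)
    have "f v = 0" if "var_ub I v = 0" for v using B[of v] that by auto
    with B show "f \<in> {f. \<forall>v. f v \<in> (if v \<in> ?J then ?B v else {0})}" by simp
  qed
  moreover have "finite {f. \<forall>v. f v \<in> (if v \<in> ?J then ?B v else {0})}"
    by (rule finite_dependent_functions[OF finite_variables fin])
  ultimately have "finite (val ` integer_points)" by (rule finite_subset)
  then show ?thesis
    by (rule finite_imageD) (simp add: inj_on_def val_inject)
qed

lemma finite_Xnet: "finite (Xnet I)"
proof (rule finite_subset)
  show "Xnet I \<subseteq> px ` integer_points"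
  proof
    fix x assume "x \<in> Xnet I"
    \<comment> \<open>Integer points need not satisfy the network constraints, so \<open>x\<close>
      can be padded with zeros.\<close>
    then have "\<lparr>px = x, py = (\<lambda>_ _. 0), pth = (\<lambda>_ _. 0), pu = (\<lambda>_ _ _. 0)\<rparr> \<in> integer_points"
      by (auto simp: Xnet_def integer_points_def y_dom_def th_dom_def u_dom_def)
    then show "x \<in> px ` integer_points" by (rule rev_image_eqI) simp
  qed
qed (simp add: finite_integer_points)

lemma finite_ord_rows: "finite (ord_rows I)"
proof (rule finite_subset)
  let ?N = "trips I" and ?H = "units I"
  \<comment> \<open>The third trip is a dummy for \<open>Cont\<close>, so that all five images share
    one index set.\<close>
  let ?K = "?N \<times> ?N \<times> ?N \<times> ?H \<times> ?H"
  let ?S = "(\<lambda>(i, j, k, a, b). CplOpp i j k a b) ` ?K \<union> (\<lambda>(i, j, k, a, b). CplSame i j k a b) ` ?K \<union>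
    (\<lambda>(i, j, k, a, b). DcpOpp i j k a b) ` ?K \<union> (\<lambda>(i, j, k, a, b). DcpSame i j k a b) ` ?K \<union>
    (\<lambda>(i, j, k, a, b). Cont i j a b) ` ?K"
  show "ord_rows I \<subseteq> ?S"
  proof
    fix r assume "r \<in> ord_rows I"
    then have "ord_index I r" by (simp add: ord_rows_def)
    then show "r \<in> ?S"
      by (cases r) (auto simp: image_iff dest!: unit_turn_trips)
  qed
  show "finite ?S" using finite_trips finite_units by simp
qed

section \<open>Compactness of the node relaxations\<close>

lemma compact_box: "compact {f. \<forall>v. 0 \<le> f v \<and> f v \<le> (ub v :: real)}"
proof -
  \<comment> \<open>Tychonoff's theorem: vectors are total functions on a possibly infinite variable
    type.\<close>
  have "compactin (product_topology (\<lambda>_. euclidean) UNIV) (PiE UNIV (\<lambda>v. {0..ub v}))"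
    by (subst compactin_PiE) simp
  moreover have "PiE UNIV (\<lambda>v. {0..ub v}) = {f. \<forall>v. 0 \<le> f v \<and> f v \<le> ub v}"
    by auto
  ultimately show ?thesis
    by (simp add: euclidean_product_topology)
qed

lemma continuous_on_coordinate: "continuous_on S (\<lambda>f. f v :: real)"
  by (rule continuous_on_subset[OF continuous_on_product_coordinates subset_UNIV])

lemma continuous_on_served [continuous_intros]:
  "continuous_on S (\<lambda>v. served I (px (point_of v)) i h)"
  by (simp add: served_def) (intro continuous_intros continuous_on_coordinate)

lemma continuous_on_qtot [continuous_intros]:
  "continuous_on S (\<lambda>v. qtot I (px (point_of v)) i)"
  unfolding qtot_def by (intro continuous_intros)

lemma continuous_on_cost: "continuous_on S (\<lambda>v. cost I (px (point_of v)))"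
  unfolding cost_def by simp (intro continuous_intros continuous_on_coordinate)

lemma continuous_on_deact [continuous_intros]: "continuous_on S (\<lambda>v. deact (px (point_of v)) r)"
  by (cases r) (simp_all, (intro continuous_intros continuous_on_coordinate)+)

lemma closed_cut: "closed {v. cut_holds I (point_of v) c}"
proof (cases c)
  case (OrdRow r)
  have "closed {v. ord_holds I (px (point_of v)) (pth (point_of v)) r}"
    by (cases r; simp only: ord_holds.simps point_of_sel(3))
      (intro closed_Collect_conj closed_Collect_le continuous_intros continuous_on_coordinate)+
  with OrdRow show ?thesis by simp
next
  case (Cycle k hs)
  show ?thesis
    unfolding Cycle cut_holds.simps point_of_sel(4)
    by (intro closed_Collect_le continuous_intros continuous_on_coordinate)
next
  case (Exclude x)
  show ?thesis
    unfolding Exclude cut_holds.simps point_of_sel split_def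
    by (intro closed_Collect_le continuous_intros continuous_on_coordinate)
qed

lemma closed_restr: "closed {v. restr_holds (point_of v) b}"
  by (cases b) (simp_all, (intro closed_Collect_le continuous_intros continuous_on_coordinate)+)

lemma closed_network: "closed {v. network I (px (point_of v)) (py (point_of v))}"
  unfolding network_def point_of_sel Ball_def
  by (intro closed_Collect_conj closed_Collect_all closed_Collect_imp open_Collect_const
      closed_Collect_le closed_Collect_eq continuous_intros continuous_on_coordinate)

lemma closed_order_linking:
  "closed {v. order_linking I (px (point_of v)) (pth (point_of v)) (pu (point_of v))}"
  unfolding order_linking_def point_of_sel(3,4) Ball_def
  by (intro closed_Collect_conj closed_Collect_all closed_Collect_imp open_Collect_const
      closed_Collect_le continuous_intros continuous_on_coordinate)

text \<open>A closed subset of the compact box: every constraint is a weak inequality or an equation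
  between continuous functions, and arbitrary intersections of closed sets are closed, whatever the
  size of \<open>C\<close> and \<open>N\<close>.\<close>

lemma compact_lp_feasible: "compact {v. point_of v \<in> lp_feasible I C N}"
proof -
  have "closed {v. \<forall>c \<in> C. cut_holds I (point_of v) c}" "closed {v. \<forall>b \<in> N. restr_holds (point_of v) b}"
    unfolding Ball_def
    by (intro closed_Collect_all closed_Collect_imp open_Collect_const closed_cut closed_restr)+
  then have "closed {v. network I (px (point_of v)) (py (point_of v)) \<and>
      order_linking I (px (point_of v)) (pth (point_of v)) (pu (point_of v)) \<and>
      (\<forall>c \<in> C. cut_holds I (point_of v) c) \<and> (\<forall>b \<in> N. restr_holds (point_of v) b)}"
    by (intro closed_Collect_conj closed_network closed_order_linking)
  from compact_Int_closed[OF compact_box[of "var_ub I"] this]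
  show ?thesis
    by (rule back_subst[where P = compact]) (auto simp: lp_feasible_def relaxed_dom_def)
qed

lemma lp_optimal_exists:
  assumes "lp_feasible I C N \<noteq> {}"
  shows "\<exists>p. lp_optimal I C N p"
proof -
  obtain q where "q \<in> lp_feasible I C N" using assms by blast
  then have "{v. point_of v \<in> lp_feasible I C N} \<noteq> {}"
    by (auto intro!: exI[of _ "val q"])
  then obtain v where v: "point_of v \<in> lp_feasible I C N"
    "\<And>w. point_of w \<in> lp_feasible I C N \<Longrightarrow> cost I (px (point_of v)) \<le> cost I (px (point_of w))"
    using continuous_attains_inf[OF compact_lp_feasible _ continuous_on_cost] by blast
  have "cost I (px (point_of v)) \<le> cost I (px p)" if "p \<in> lp_feasible I C N" for p
    using v(2)[of "val p"] that by simp
  with v(1) have "lp_optimal I C N (point_of v)"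
    by (auto simp: lp_optimal_def is_arg_min_def not_less)
  then show ?thesis ..
qed

section \<open>Cuts and the search invariant\<close>

text \<open>A finite universe containing every cut the method can add. Exclusion cuts are restricted
  to non-orderable assignments, as only rejected candidates are excluded.\<close>

definition admissible_cuts :: "('n, 'h) cut set" where
  "admissible_cuts = OrdRow ` ord_rows I \<union> {Cycle k hs | k hs. cycle_index I k hs} \<union>
     Exclude ` (Xnet I - Xord I)"

lemma finite_admissible_cuts: "finite admissible_cuts"
proof -
  have "{Cycle k hs | k hs. cycle_index I k hs}
      \<subseteq> (\<lambda>(k, hs). Cycle k hs) ` (trips I \<times> {hs. set hs \<subseteq> units I \<and> distinct hs})"
    by (auto simp: cycle_index_def)
  moreover have "finite {hs. set hs \<subseteq> units I \<and> distinct hs}"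
    by (rule finite_subset_distinct[OF finite_units])
  ultimately have "finite {Cycle k hs | k hs. cycle_index I k hs}"
    using finite_trips finite_subset by (meson finite_SigmaI finite_imageI)
  then show ?thesis
    using finite_ord_rows finite_Xnet by (simp add: admissible_cuts_def)
qed

text \<open>A violated inequality would force every \<open>u\<close> on the cycle to 0 and every
  unit to serve the trip; then \<open>\<theta>\<close> would strictly increase all the way
  round.\<close>

lemma cycle_cut_valid:
  assumes z: "z \<in> Pfull I" and c: "cycle_index I k hs"
  shows "cut_holds I z (Cycle k hs)"
proof (rule ccontr)
  let ?n = "length hs"
  let ?s = "\<lambda>r. served I (px z) k (hs ! r)" and ?u = "\<lambda>r. pu z k (hs ! r) (hs ! (Suc r mod ?n))"
  assume "\<not> cut_holds I z (Cycle k hs)"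
  then have less: "(\<Sum>r<?n. ?u r) < (\<Sum>r<?n. ?s r) - (real ?n - 1)" by simp
  have k: "k \<in> trips I" and hs: "2 \<le> ?n" "distinct hs" "set hs \<subseteq> units I"
    using c by (auto simp: cycle_index_def)
  have x: "px z \<in> Xnet I" and ud: "u_dom I (pu z)" and lin: "order_linking I (px z) (pth z) (pu z)"
    using z by (auto simp: Pfull_def Xnet_def)
  have un: "hs ! r \<in> units I" if "r < ?n" for r using hs that by auto
  have s01: "?s r = 0 \<or> ?s r = 1" if "r < ?n" for r
    using served_cases[OF x un[OF that] k] .
  have u01: "?u r = 0 \<or> ?u r = 1" for r using u_dom_cases[OF ud] .
  \<comment> \<open>Spreading the constant over the cycle adds 1 to each of the \<open>?n\<close>
    terms. These are nonnegative integers, so a total below 1 makes each of them 0.\<close>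
  have "(\<Sum>r<?n. ?u r - ?s r + 1) < 1"
    using less by (simp add: sum.distrib sum_subtractf)
  moreover have "0 \<le> ?u r - ?s r + 1" if "r < ?n" for r
    using s01[OF that] u01[of r] by auto
  ultimately have small: "?u r - ?s r + 1 < 1" if "r < ?n" for r
    using member_le_sum[of r "{..<?n}" "\<lambda>r. ?u r - ?s r + 1"] that by fastforce
  have one: "?u r = 0" "?s r = 1" if "r < ?n" for r
    using small[OF that] s01[OF that] u01[of r] by auto
  have "pth z k (hs ! r) < pth z k (hs ! (Suc r mod ?n))" if r: "r < ?n" for r
  proof (rule order_linking_increase(1)[OF lin k])
    have r': "Suc r mod ?n < ?n" using hs(1) by (intro mod_less_divisor) linarith
    show "hs ! r \<in> U_set I (px z) k" "hs ! (Suc r mod ?n) \<in> U_set I (px z) k"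
      using one(2)[OF r] one(2)[OF r'] un[OF r] un[OF r'] by (auto simp: U_set_def)
    \<comment> \<open>Length at least 2 is used here: consecutive cycle members must be different
      units.\<close>
    have "r \<noteq> Suc r mod ?n"
      using hs r by (cases "Suc r = ?n") auto
    then show "hs ! r \<noteq> hs ! (Suc r mod ?n)"
      using hs(2) r r' by (simp add: nth_eq_iff_index_eq)
  qed (rule one(1)[OF r])
  then show False
    using cyclic_increase_impossible[of hs "pth z k"] hs by fastforce
qed

lemma exclude_self:
  assumes "px p = x"
  shows "\<not> cut_holds I p (Exclude x)"
proof -
  have "(\<Sum>(h, a) \<in> {(h, a) \<in> Sigma (units I) (uarcs I). x h a = 1}. 1 - px p h a) = 0"
    "(\<Sum>(h, a) \<in> {(h, a) \<in> Sigma (units I) (uarcs I). x h a = 0}. px p h a) = 0"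
    using assms by (auto intro!: sum.neutral)
  then show ?thesis by simp
qed

text \<open>Between binary vectors the left-hand side of the cut is the Hamming distance, which is
  at least 1 unless they coincide.\<close>

lemma exclude_other:
  assumes p: "x_dom I (px p)" and x: "x_dom I x" and ne: "px p \<noteq> x"
  shows "cut_holds I p (Exclude x)"
proof -
  let ?K = "Sigma (units I) (uarcs I)"
  let ?A = "{(h, a) \<in> ?K. x h a = 1}" and ?B = "{(h, a) \<in> ?K. x h a = 0}"
  let ?f = "\<lambda>(h, a). 1 - px p h a" and ?g = "\<lambda>(h, a). px p h a"
  have fin: "finite ?K" using finite_units finite_uarcs by auto
  then have finAB: "finite ?A" "finite ?B" by (auto intro: finite_subset[OF _ fin])
  have nonneg: "0 \<le> ?f e" "0 \<le> ?g e" for e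
    using x_nonneg[OF p] x_le_1[OF p] by (auto split: prod.splits)
  obtain h a where ha: "px p h a \<noteq> x h a" using ne by (metis ext)
  have dom: "x h a \<in> (if h \<in> units I \<and> a \<in> uarcs I h then {0, 1} else {0})"
    "px p h a \<in> (if h \<in> units I \<and> a \<in> uarcs I h then {0, 1} else {0})"
    using p x unfolding x_dom_def by blast+
  \<comment> \<open>Both vectors vanish off the index set, so the coordinate where they differ is
    counted by the cut.\<close>
  with ha have K: "(h, a) \<in> ?K" by (auto split: if_splits)
  with ha dom consider "x h a = 1" "px p h a = 0" | "x h a = 0" "px p h a = 1" by auto
  then have "1 \<le> sum ?f ?A + sum ?g ?B"
  proof cases
    case 1
    have "?f (h, a) \<le> sum ?f ?A"
      using 1 K by (intro member_le_sum finAB nonneg) auto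
    moreover have "0 \<le> sum ?g ?B" by (rule sum_nonneg) (rule nonneg)
    ultimately show ?thesis using 1 by simp
  next
    case 2
    have "?g (h, a) \<le> sum ?g ?B"
      using 2 K by (intro member_le_sum finAB nonneg) auto
    moreover have "0 \<le> sum ?f ?A" by (rule sum_nonneg) (rule nonneg)
    ultimately show ?thesis using 2 by simp
  qed
  then show ?thesis by simp
qed

lemma admissible_cut_valid:
  assumes z: "z \<in> Pfull I" and c: "c \<in> admissible_cuts"
  shows "cut_holds I z c"
  using c unfolding admissible_cuts_def
proof (elim UnE)
  assume "c \<in> OrdRow ` ord_rows I"
  then show ?thesis using z by (auto simp: Pfull_def)
next
  assume "c \<in> {Cycle k hs | k hs. cycle_index I k hs}"
  then show ?thesis using cycle_cut_valid[OF z] by auto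
next
  assume "c \<in> Exclude ` (Xnet I - Xord I)"
  then obtain x where x: "c = Exclude x" "x_dom I x" "x \<notin> Xord I" by (auto simp: Xnet_def)
  moreover have "px z \<in> Xord I" using z Xord_eq by blast
  moreover have "x_dom I (px z)" using z by (auto simp: Pfull_def)
  ultimately show ?thesis using exclude_other[of z x] by auto
qed

section \<open>Full-formulation points in the search tree\<close>

lemma node_int_points_eq: "node_int_points I N = {p \<in> integer_points. \<forall>b \<in> N. restr_holds p b}"
  by (auto simp: node_int_points_def integer_points_def)

lemma finite_node_int_points: "finite (node_int_points I N)"
  by (simp add: node_int_points_eq finite_integer_points)

text \<open>The bridge from relaxations to the full formulation: it makes infeasibility pruning safe
  and each lower bound valid for the full points of its node.\<close>

lemma Pfull_lp_feasible:
  assumes z: "z \<in> Pfull I" and N: "z \<in> node_int_points I N" and C: "C \<subseteq> admissible_cuts"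
  shows "z \<in> lp_feasible I C N"
proof -
  have "z \<in> integer_points" using N by (simp add: node_int_points_eq)
  then have "relaxed_dom I z"
    by (auto simp: integer_points_iff relaxed_dom_def Ball_def image_iff) (metis of_nat_0_le_iff)+
  then show ?thesis
    using assms admissible_cut_valid[OF z] by (auto simp: lp_feasible_def Pfull_def node_int_points_def)
qed

lemma lower_bound_le: "p \<in> lp_feasible I C N \<Longrightarrow> lower_bound I C N \<le> ereal (cost I (px p))"
  unfolding lower_bound_def by (rule INF_lower)

lemma lp_optimal_le_lower_bound:
  "lp_optimal I C N p \<Longrightarrow> ereal (cost I (px p)) \<le> lower_bound I C N"
  unfolding lower_bound_def lp_optimal_def is_arg_min_def by (force intro!: INF_greatest)

text \<open>The last conjunct says that no point still worth finding has been lost. Before the first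
  incumbent \<open>improves\<close> holds trivially, so all of \<open>Pfull I\<close> must be
  covered. Finiteness of \<open>open_nodes\<close> is needed for the multiset in the termination
  measure.\<close>

definition search_invariant :: "('n, 't, 'h) tstate \<Rightarrow> bool" where
  "search_invariant s \<longleftrightarrow> finite (open_nodes s) \<and> pool s \<subseteq> admissible_cuts \<and>
     (\<forall>z. incumbent s = Some z \<longrightarrow> z \<in> Pfull I) \<and>
     (\<forall>z \<in> Pfull I. improves I (ereal (cost I (px z))) s \<longrightarrow>
        (\<exists>N \<in> open_nodes s. z \<in> node_int_points I N))"

lemma search_invariant_init:
  assumes "R0 \<subseteq> ord_rows I"
  shows "search_invariant (tusou_init R0)"
  using assms
  by (auto simp: search_invariant_def tusou_init_def admissible_cuts_def Pfull_def node_int_points_def)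

lemma search_invariant_prune:
  assumes inv: "search_invariant s"
    and N: "\<And>z. z \<in> Pfull I \<Longrightarrow> z \<in> node_int_points I N \<Longrightarrow> \<not> improves I (ereal (cost I (px z))) s"
  shows "search_invariant (s\<lparr>open_nodes := open_nodes s - {N}\<rparr>)"
proof -
  have "\<exists>M \<in> open_nodes s - {N}. z \<in> node_int_points I M"
    if z: "z \<in> Pfull I" "improves I (ereal (cost I (px z))) s" for z
  proof -
    obtain M where M: "M \<in> open_nodes s" "z \<in> node_int_points I M"
      using inv z by (auto simp: search_invariant_def)
    with N[OF z(1)] z(2) have "M \<noteq> N" by auto
    with M show ?thesis by blast
  qed
  then show ?thesis
    using inv by (auto simp: search_invariant_def improves_def)
qed

lemma search_invariant_pool:
  assumes "search_invariant s" "C \<subseteq> admissible_cuts"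
  shows "search_invariant (s\<lparr>pool := pool s \<union> C\<rparr>)"
  using assms by (auto simp: search_invariant_def improves_def)

lemma search_invariant_step:
  assumes br: "complete_branching I br" and inv: "search_invariant s" and step: "tusou_step I br s s'"
  shows "search_invariant s'"
  using step
proof cases
  case (prune_infeasible N)
  have "z \<in> lp_feasible I (pool s) N" if "z \<in> Pfull I" "z \<in> node_int_points I N" for z
    using Pfull_lp_feasible[OF that] inv by (simp add: search_invariant_def)
  with prune_infeasible show ?thesis
    using search_invariant_prune[OF inv, of N] by blast
next
  case (prune_bound N)
  have "\<not> improves I (ereal (cost I (px z))) s" if "z \<in> Pfull I" "z \<in> node_int_points I N" for z
  proof -
    have "lower_bound I (pool s) N \<le> ereal (cost I (px z))"
      using lower_bound_le[OF Pfull_lp_feasible[OF that]] inv by (simp add: search_invariant_def)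
    with prune_bound(3) show ?thesis
      unfolding improves_def by (meson le_less_trans)
  qed
  with prune_bound show ?thesis
    using search_invariant_prune[OF inv, of N] by blast
next
  case (add_cycle_cuts N p C)
  then have "C \<subseteq> admissible_cuts" by (auto simp: admissible_cuts_def)
  with add_cycle_cuts show ?thesis using search_invariant_pool[OF inv] by simp
next
  case (accept_candidate x \<theta> u y)
  let ?z = "\<lparr>px = x, py = y, pth = \<theta>, pu = u\<rparr>"
  have "?z \<in> Pfull I"
    using accept_candidate accept_in_Omega[of x \<theta> u] by (auto simp: Pfull_iff Xnet_def)
  \<comment> \<open>A new incumbent is strictly cheaper, so the set of points that open nodes must
    cover can only shrink.\<close>
  moreover have "improves I w s" if "improves I w s'" for w
    using that accept_candidate by (auto simp: improves_def intro: less_trans)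
  ultimately show ?thesis
    using inv accept_candidate by (auto simp: search_invariant_def)
next
  case (lazy_recovery x S R)
  then have "OrdRow ` R \<subseteq> admissible_cuts"
    using reject_active[of x S] by (auto simp: admissible_cuts_def active_def)
  with lazy_recovery show ?thesis using search_invariant_pool[OF inv] by simp
next
  case (exclude_assignment x S)
  then have "{Exclude x} \<subseteq> admissible_cuts"
    using reject_not_orderable[of x S] by (auto simp: admissible_cuts_def)
  with exclude_assignment show ?thesis using search_invariant_pool[OF inv, of "{Exclude x}"] by simp
next
  case (branch N p)
  then have b: "finite (br s N p)" "node_int_points I N = (\<Union>M \<in> br s N p. node_int_points I M)"
    using br unfolding complete_branching_def by blast+
  have "\<exists>M \<in> open_nodes s'. z \<in> node_int_points I M"
    if z: "z \<in> Pfull I" "improves I (ereal (cost I (px z))) s" for z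
  proof -
    obtain M where "M \<in> open_nodes s" "z \<in> node_int_points I M"
      using inv z by (auto simp: search_invariant_def)
    then show ?thesis using b(2) branch(1) by (cases "M = N") auto
  qed
  then show ?thesis
    using inv b(1) branch(1) by (auto simp: search_invariant_def improves_def)
qed

lemma search_invariant_reachable:
  assumes "R0 \<subseteq> ord_rows I" "complete_branching I br" "tusou_reachable I br R0 s"
  shows "search_invariant s"
  using assms(3) unfolding tusou_reachable_def
proof (induction rule: rtranclp_induct)
  case base
  show ?case by (rule search_invariant_init[OF assms(1)])
next
  case (step s s')
  then show ?case using search_invariant_step[OF assms(2)] by blast
qed

section \<open>Termination\<close>

text \<open>Cut additions lower the first component, acceptance lowers the second without changing
  the pool, and pruning or branching lowers the third while pool and incumbent stay fixed. The image
  multiset keeps different nodes with equal counts apart.\<close>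

definition progress :: "('n, 't, 'h) tstate \<Rightarrow> nat \<times> nat \<times> nat multiset" where
  "progress s = (card (admissible_cuts - pool s), card {x \<in> Xnet I. improves I (ereal (cost I x)) s},
     image_mset (\<lambda>N. card (node_int_points I N)) (mset_set (open_nodes s)))"

abbreviation progress_order :: "((nat \<times> nat \<times> nat multiset) \<times> (nat \<times> nat \<times> nat multiset)) set" where
  "progress_order \<equiv> less_than <*lex*> less_than <*lex*> mult less_than"

lemma progress_pool:
  assumes C: "C \<subseteq> admissible_cuts" "\<not> C \<subseteq> pool s"
  shows "(progress (s\<lparr>pool := pool s \<union> C\<rparr>), progress s) \<in> progress_order"
proof -
  have "card (admissible_cuts - (pool s \<union> C)) < card (admissible_cuts - pool s)"
    using C finite_admissible_cuts by (intro psubset_card_mono) auto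
  then show ?thesis by (simp add: progress_def)
qed

text \<open>Covers branching and, with \<open>Q = {}\<close>, both kinds of pruning: one count is
  replaced by finitely many smaller ones.\<close>

lemma progress_replace:
  assumes inv: "search_invariant s" and N: "N \<in> open_nodes s" and Q: "finite Q"
    and less: "\<And>M. M \<in> Q \<Longrightarrow> node_int_points I M \<subset> node_int_points I N"
  shows "(progress (s\<lparr>open_nodes := (open_nodes s - {N}) \<union> Q\<rparr>), progress s) \<in> progress_order"
proof -
  let ?A = "open_nodes s - {N}" and ?f = "\<lambda>N. card (node_int_points I N)"
  have fin: "finite (open_nodes s)" using inv by (simp add: search_invariant_def)
  \<comment> \<open>Nodes are sets of restrictions, so a child may already be open; only the new
    ones contribute.\<close>
  have "mset_set (?A \<union> (Q - ?A)) = mset_set ?A + mset_set (Q - ?A)"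
    using fin Q by (intro mset_set_Union) auto
  then have new: "mset_set (?A \<union> Q) = mset_set ?A + mset_set (Q - ?A)"
    by (simp only: Un_Diff_cancel)
  have old: "mset_set (open_nodes s) = mset_set ?A + {#N#}"
    using mset_set.remove[OF fin N] by simp
  have "(image_mset ?f (mset_set ?A) + image_mset ?f (mset_set (Q - ?A)),
      image_mset ?f (mset_set ?A) + {#?f N#}) \<in> mult less_than"
  proof (rule one_step_implies_mult)
    show "\<forall>k \<in> set_mset (image_mset ?f (mset_set (Q - ?A))). \<exists>j \<in> set_mset {#?f N#}. (k, j) \<in> less_than"
      using Q less psubset_card_mono[OF finite_node_int_points] by auto
  qed simp
  then have "(image_mset ?f (mset_set (?A \<union> Q)), image_mset ?f (mset_set (open_nodes s))) \<in> mult less_than"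
    unfolding new old by simp
  then show ?thesis by (simp add: progress_def improves_def)
qed

lemma progress_step:
  assumes br: "complete_branching I br" and inv: "search_invariant s" and step: "tusou_step I br s s'"
  shows "(progress s', progress s) \<in> progress_order"
  using step
proof cases
  case (prune_infeasible N)
  then show ?thesis using progress_replace[OF inv, of N "{}"] by simp
next
  case (prune_bound N)
  then show ?thesis using progress_replace[OF inv, of N "{}"] by simp
next
  case (add_cycle_cuts N p C)
  then have "C \<subseteq> admissible_cuts" by (auto simp: admissible_cuts_def)
  moreover have "\<forall>c \<in> pool s. cut_holds I p c"
    using add_cycle_cuts(3) by (auto simp: lp_optimal_def is_arg_min_def lp_feasible_def)
  \<comment> \<open>The relaxation optimum satisfies the whole pool but violates every cut in the
    nonempty \<open>C\<close>.\<close>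
  then have "\<not> C \<subseteq> pool s" using add_cycle_cuts(4,5) by blast
  ultimately show ?thesis using progress_pool add_cycle_cuts(1) by simp
next
  case (accept_candidate x \<theta> u y)
  have "improves I w s" if "improves I w s'" for w
    using that accept_candidate by (auto simp: improves_def intro: less_trans)
  \<comment> \<open>The accepted \<open>x\<close> itself leaves the set, since it cannot beat its
    own cost.\<close>
  moreover have "\<not> improves I (ereal (cost I x)) s'"
    using accept_candidate by (simp add: improves_def)
  ultimately have "{x \<in> Xnet I. improves I (ereal (cost I x)) s'} \<subset> {x \<in> Xnet I. improves I (ereal (cost I x)) s}"
    using accept_candidate by auto
  then have "card {x \<in> Xnet I. improves I (ereal (cost I x)) s'} < card {x \<in> Xnet I. improves I (ereal (cost I x)) s}"
    using finite_Xnet by (intro psubset_card_mono) auto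
  then show ?thesis using accept_candidate(1) by (simp add: progress_def)
next
  case (lazy_recovery x S R)
  then have "OrdRow ` R \<subseteq> admissible_cuts"
    using reject_active[of x S] by (auto simp: admissible_cuts_def active_def)
  moreover have "\<not> OrdRow ` R \<subseteq> pool s" using lazy_recovery by blast
  ultimately show ?thesis using progress_pool lazy_recovery(1) by simp
next
  case (exclude_assignment x S)
  then have "{Exclude x} \<subseteq> admissible_cuts"
    using reject_not_orderable[of x S] by (auto simp: admissible_cuts_def)
  then show ?thesis
    using progress_pool[of "{Exclude x}" s] exclude_assignment by simp
next
  case (branch N p)
  then have "finite (br s N p) \<and> (\<forall>M \<in> br s N p. node_int_points I M \<subset> node_int_points I N)"
    using br[unfolded complete_branching_def, THEN spec[of _ s], THEN spec[of _ N], THEN spec[of _ p]]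
    by blast
  then show ?thesis using progress_replace[OF inv, of N "br s N p"] branch by simp
qed

lemma no_infinite_run:
  assumes R0: "R0 \<subseteq> ord_rows I" and br: "complete_branching I br"
    and run: "\<sigma> 0 = tusou_init R0" "\<And>n::nat. tusou_step I br (\<sigma> n) (\<sigma> (Suc n))"
  shows False
proof -
  have inv: "search_invariant (\<sigma> n)" for n
  proof (induction n)
    case 0
    show ?case using search_invariant_init[OF R0] run(1) by simp
  next
    case (Suc n)
    then show ?case using search_invariant_step[OF br _ run(2)] by blast
  qed
  have wf: "wf progress_order"
    by (intro wf_lex_prod wf_mult wf_less_than)
  have "(progress (\<sigma> (Suc n)), progress (\<sigma> n)) \<in> progress_order" for n
    by (rule progress_step[OF br inv run(2)])
  then show False
    using wf_no_infinite_down_chainE[OF wf, of "\<lambda>n. progress (\<sigma> n)"] by blast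
qed

text \<open>No run gets stuck at an open node. If the node cannot be pruned, its relaxation has an
  optimum, which is either branched on or certified.\<close>

lemma open_node_step:
  assumes N: "N \<in> open_nodes s"
  shows "\<exists>s'. tusou_step I br s s'"
proof (cases "lp_feasible I (pool s) N = {} \<or> \<not> improves I (lower_bound I (pool s) N) s")
  case True
  then show ?thesis
    using tusou_step.prune_infeasible[OF N] tusou_step.prune_bound[OF N] by blast
next
  case False
  then obtain p where p: "lp_optimal I (pool s) N p" and imp: "improves I (lower_bound I (pool s) N) s"
    using lp_optimal_exists by blast
  have op: "open_nodes s \<noteq> {}" using N by blast
  show ?thesis
  proof (cases "px p \<in> Xnet I")
    case False
    from tusou_step.branch[OF N imp p this] show ?thesis by blast
  next
    case x: True
    obtain v where v: "certifies I (px p) v" using certification_total by blast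
    show ?thesis
    proof (cases v)
      case (Accept \<theta> u)
      obtain y where "y_dom I y" "network I (px p) y" using x by (auto simp: Xnet_def)
      \<comment> \<open>The cost of the optimum is at most the lower bound, which beats the
        incumbent as the node was not prunable.\<close>
      moreover have "improves I (ereal (cost I (px p))) s"
        using imp lp_optimal_le_lower_bound[OF p] unfolding improves_def by (meson le_less_trans)
      ultimately show ?thesis
        using tusou_step.accept_candidate[OF op x v[unfolded Accept]] by blast
    next
      case (Reject S)
      note r = v[unfolded Reject]
      have "\<forall>c \<in> pool s. cut_holds I p c"
        using p by (auto simp: lp_optimal_def is_arg_min_def lp_feasible_def)
      \<comment> \<open>\<open>p\<close> violates its own exclusion cut yet satisfies the pool. So
        either some row of \<open>S\<close> is absent and can be recovered, or this cut is
        new.\<close>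
      then have "Exclude (px p) \<notin> pool s" using exclude_self[OF refl] by blast
      then show ?thesis
        using tusou_step.exclude_assignment[OF op x r] tusou_step.lazy_recovery[OF op x r _ subset_refl]
        by blast
    qed
  qed
qed

section \<open>Optimality\<close>

text \<open>The objective depends only on \<open>x\<close>, and \<open>Xord I\<close> is the
  projection of \<open>Pfull I\<close>.\<close>

lemma optimal_ord_iff_full: "z \<in> Pfull I \<Longrightarrow> optimal_ord I (px z) \<longleftrightarrow> optimal_full I z"
  by (auto simp: optimal_ord_def optimal_full_def is_arg_min_def Xord_eq)

text \<open>A cheaper full point would improve on the incumbent and so lie in an open node, whose
  lower bound would then fall below the incumbent value. Without open nodes the invariant already
  excludes such a point.\<close>

lemma zero_gap_optimal:
  assumes inv: "search_invariant s" and gap: "zero_gap I s z"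
  shows "z \<in> Pfull I" "optimal_full I z"
proof -
  have inc: "incumbent s = Some z"
    and bound: "ereal (cost I (px z)) \<le> (INF N \<in> open_nodes s. lower_bound I (pool s) N)"
    using gap by (auto simp: zero_gap_def)
  show z: "z \<in> Pfull I" using inv inc by (simp add: search_invariant_def)
  have "cost I (px z) \<le> cost I (px w)" if w: "w \<in> Pfull I" for w
  proof (rule ccontr)
    assume less: "\<not> ?thesis"
    then obtain N where N: "N \<in> open_nodes s" "w \<in> node_int_points I N"
      using inv inc w by (auto simp: search_invariant_def improves_def not_le)
    have "ereal (cost I (px z)) \<le> lower_bound I (pool s) N"
      using bound N(1) by (auto simp: le_INF_iff)
    also have "\<dots> \<le> ereal (cost I (px w))"
      using lower_bound_le[OF Pfull_lp_feasible[OF w N(2)]] inv by (simp add: search_invariant_def)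
    finally show False using less by simp
  qed
  with z show "optimal_full I z"
    by (auto simp: optimal_full_def is_arg_min_def not_less)
qed

end

text \<open>Termination is expressed by two conjuncts, no infinite run and no open node in a state
  without successor, so that stopping early cannot count as termination.\<close>

theorem proposition5p1:
  fixes I :: "('n, 't, 'h) rolling"
    and R0 :: "('n, 'h) ordinst set"
    and br :: "('n, 't, 'h) brule"
  assumes "rolling_instance I"
    and "R0 \<subseteq> ord_rows I"
    and "complete_branching I br"
  shows
    "(\<nexists>\<sigma>. \<sigma> 0 = tusou_init R0 \<and> (\<forall>n::nat. tusou_step I br (\<sigma> n) (\<sigma> (Suc n)))) \<and>
     (\<forall>s. tusou_reachable I br R0 s \<and> (\<nexists>s'. tusou_step I br s s') \<longrightarrow> open_nodes s = {}) \<and>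
     (\<forall>s z. tusou_reachable I br R0 s \<and> incumbent s = Some z \<longrightarrow> z \<in> Pfull I) \<and>
     (\<forall>s z. tusou_reachable I br R0 s \<and> zero_gap I s z \<longrightarrow>
        optimal_ord I (px z) \<and> optimal_full I z) \<and>
     (\<forall>z \<in> Pfull I. optimal_ord I (px z) \<longleftrightarrow> optimal_full I z)"
proof -
  interpret valid_instance I by unfold_locales (rule assms(1))
  note inv = search_invariant_reachable[OF assms(2,3)]
  show ?thesis
  proof (intro conjI allI impI ballI)
    show "\<nexists>\<sigma>. \<sigma> 0 = tusou_init R0 \<and> (\<forall>n::nat. tusou_step I br (\<sigma> n) (\<sigma> (Suc n)))"
      using no_infinite_run[OF assms(2,3)] by blast
  next
    fix s assume "tusou_reachable I br R0 s \<and> (\<nexists>s'. tusou_step I br s s')"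
    then show "open_nodes s = {}" using open_node_step by blast
  next
    fix s z assume "tusou_reachable I br R0 s \<and> incumbent s = Some z"
    then show "z \<in> Pfull I" using inv by (auto simp: search_invariant_def)
  next
    fix s z assume "tusou_reachable I br R0 s \<and> zero_gap I s z"
    then show "optimal_ord I (px z)" "optimal_full I z"
      using zero_gap_optimal[OF inv] optimal_ord_iff_full by blast+
  qed (rule optimal_ord_iff_full)
qed

end
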